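(* Assume $0<\lambda<1$, let $(a_n)_{n=0}^{\infty}\subset S^1$ be a greedy $\lambda$-energy sequence with $a_0=1$, and let $\alpha_{N,\lambda}=(a_0,\ldots,a_{N-1})$, $N\geq 2$. The sequence $$\left(\frac{H_\lambda(\alpha_{N,\lambda})-N^2\,I_\lambda(\sigma_1)}{N^{1-\lambda}}\right)_{N=2}^{\infty}$$ is bounded and divergent (i.e., not convergent), and we have $$\limsup_{N\to\infty}\frac{H_\lambda(\alpha_{N,\lambda})-N^2 I_\lambda(\sigma_1)}{N^{1-\lambda}}=(2\pi)^\lambda\,2\zeta(-\lambda),$$ $$\liminf_{N\to\infty}\frac{H_\lambda(\alpha_{N,\lambda})-N^2 I_\lambda(\sigma_1)}{N^{1-\lambda}}=\overline{g}(\lambda)\,(2\pi)^\lambda\,2\zeta(-\lambda).$$ For any $p\geq 1$ and $\vec\theta\in\Theta_p$, the value $G(\vec\theta;\lambda)\,(2\pi)^\lambda\,2\zeta(-\lambda)$ is a limit point of the sequence $\left(\frac{H_\lambda(\alpha_{N,\lambda})-N^2\,I_\lambda(\sigma_1)}{N^{1-\lambda}}\right)_{N=2}^{\infty}$, i.e., there is a subsequence converging to this value.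
   Context: $S^1$ is the unit circle, viewed as the set of complex numbers of modulus $1$. For $\lambda>0$, a greedy $\lambda$-energy sequence on $S^1$ is a sequence $(a_n)_{n=0}^{\infty}\subset S^1$ such that $\sum_{k=0}^{n-1}|a_n-a_k|^{\lambda}=\max_{x\in S^1}\sum_{k=0}^{n-1}|x-a_k|^{\lambda}$ for all $n\geq 1$. For a configuration $\omega_N=(y_0,\ldots,y_{N-1})$ of $N\ge2$ points, $H_\lambda(\omega_N)=\sum_{0\le i\neq j\le N-1}|y_i-y_j|^\lambda$. $\sigma_1$ is the normalized arc-length (uniform probability) measure on $S^1$, and $I_\lambda(\sigma_1)=\iint_{S^1\times S^1}|x-y|^\lambda\,d\sigma_1(x)\,d\sigma_1(y)=\frac{2^{\lambda}\,\Gamma((1+\lambda)/2)}{\sqrt{\pi}\,\Gamma(1+\lambda/2)}$. $\zeta$ is the Riemann zeta function, meromorphically continued to $\mathbb{C}$. For $p\in\mathbb{N}=\{1,2,\ldots\}$, $\Theta_p$ is the set of all vectors $\vec\theta=(\theta_1,\ldots,\theta_p)$ for which there exists an infinite sequence $\mathcal{N}$ of integers $N=2^{n_1}+\cdots+2^{n_p}$, $n_1>n_2>\cdots>n_p\geq 0$ (the $n_i$ depending on $N$), such that $\lim_{N\in\mathcal{N}}2^{n_i}/N=\theta_i$ for all $i=1,\ldots,p$. For $\vec\theta\in\Theta_p$ and $0\le\lambda<1$, $$G((\theta_1,\ldots,\theta_p);\lambda)=\sum_{k=1}^{p}\theta_k^{-\lambda}\Big(2(2^{-\lambda}-1)\Big(\sum_{j=k+1}^{p}\theta_j\Big)+\theta_k\Big),$$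 where the inner sum is zero if $k=p$, and the whole $k$-th term is understood to be zero if $\theta_k=0$. Finally, $\overline{g}_p(\lambda)=\sup_{\vec\theta\in\Theta_p}G(\vec\theta;\lambda)$ and $\overline{g}(\lambda)=\sup_{p\in\mathbb{N}}\overline{g}_p(\lambda)$. *)

theory Defs
  imports "HOL-Complex_Analysis.Complex_Analysis" "HOL-Library.FuncSet"
begin

text \<open>The library has no Riemann zeta function. It is taken to be the unique meromorphic function
  on the complex plane that agrees with the Dirichlet series on the half-plane \<open>Re s > 1\<close>. The
  predicate \<^const>\<open>nicely_meromorphic_on\<close> normalises removable singularities away and fixes the
  value \<open>0\<close> at poles; this makes the continuation unique as a total function.\<close>

definition riemann_zeta :: "complex \<Rightarrow> complex" where
  "riemann_zeta = (THE f. f nicely_meromorphic_on UNIV \<and>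
     (\<forall>s. Re s > 1 \<longrightarrow> (\<lambda>n. 1 / of_nat (Suc n) powr s) sums f s))"

definition unit_circle :: "complex set" where
  "unit_circle = sphere 0 1"

text \<open>Normalised arc length on the circle, as a Borel probability measure on the plane that is
  concentrated on the circle.\<close>

definition sigma1 :: "complex measure" where
  "sigma1 = distr (uniform_measure lborel {0..2 * pi}) borel cis"

definition I_energy :: "real \<Rightarrow> complex measure \<Rightarrow> real" where
  "I_energy lam \<mu> = (LINT x|\<mu>. LINT y|\<mu>. dist x y powr lam)"

definition greedy_energy_seq :: "real \<Rightarrow> (nat \<Rightarrow> complex) \<Rightarrow> bool" where
  "greedy_energy_seq lam a \<longleftrightarrow>
     (\<forall>n. a n \<in> unit_circle) \<and>
     (\<forall>n\<ge>1. \<forall>x\<in>unit_circle.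
        (\<Sum>k<n. dist x (a k) powr lam) \<le> (\<Sum>k<n. dist (a n) (a k) powr lam))"

text \<open>The energy of the configuration \<open>(y 0, \<dots>, y (N - 1))\<close>; the sum is over ordered
  pairs of distinct indices.\<close>

definition H_energy :: "real \<Rightarrow> nat \<Rightarrow> (nat \<Rightarrow> complex) \<Rightarrow> real" where
  "H_energy lam N y = (\<Sum>i<N. \<Sum>j\<in>{..<N} - {i}. dist (y i) (y j) powr lam)"

text \<open>A vector of length \<open>p\<close> is an extensional function on \<open>{1..p}\<close>. The infinite sequence of
  integers is \<open>N\<close>, and \<open>e m i\<close> is the \<open>i\<close>-th exponent in the binary expansion of \<open>N m\<close>.\<close>

definition Theta :: "nat \<Rightarrow> (nat \<Rightarrow> real) set" where
  "Theta p = {\<theta> \<in> extensional {1..p}.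
     \<exists>(N :: nat \<Rightarrow> nat) (e :: nat \<Rightarrow> nat \<Rightarrow> nat).
       strict_mono N \<and>
       (\<forall>m. N m = (\<Sum>i=1..p. 2 ^ e m i)) \<and>
       (\<forall>m. \<forall>i\<in>{1..p}. \<forall>j\<in>{1..p}. i < j \<longrightarrow> e m j < e m i) \<and>
       (\<forall>i\<in>{1..p}. (\<lambda>m. 2 ^ e m i / real (N m)) \<longlonglongrightarrow> \<theta> i)}"

definition G :: "nat \<Rightarrow> (nat \<Rightarrow> real) \<Rightarrow> real \<Rightarrow> real" where
  "G p \<theta> lam = (\<Sum>k=1..p. if \<theta> k = 0 then 0 else
     \<theta> k powr (-lam) * (2 * (2 powr (-lam) - 1) * (\<Sum>j=k+1..p. \<theta> j) + \<theta> k))"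

text \<open>The suprema are taken in the extended reals, so that no boundedness is presupposed.\<close>

definition g_bar_p :: "nat \<Rightarrow> real \<Rightarrow> ereal" where
  "g_bar_p p lam = (SUP \<theta>\<in>Theta p. ereal (G p \<theta> lam))"

definition g_bar :: "real \<Rightarrow> ereal" where
  "g_bar lam = (SUP p\<in>{1..}. g_bar_p p lam)"

definition normalized_energy :: "real \<Rightarrow> (nat \<Rightarrow> complex) \<Rightarrow> nat \<Rightarrow> real" where
  "normalized_energy lam a N =
     (H_energy lam N a - real N ^ 2 * I_energy lam sigma1) / real N powr (1 - lam)"

text \<open>The number \<open>(2 * pi) powr lam * 2 * \<zeta>(-lam)\<close>; zeta is real on the real axis, so the real part only
  serves as a coercion.\<close>

definition zeta_const :: "real \<Rightarrow> real" where
  "zeta_const lam = (2 * pi) powr lam * (2 * Re (riemann_zeta (complex_of_real (-lam))))"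

end

theory Submission
  imports Defs
begin

text \<open>
  The function \<open>t \<mapsto> \<bar>2 sin t\<bar> powr lam\<close>, which is the kernel
  \<open>\<bar>x - y\<bar> powr lam\<close> in half-angles, is concave on \<open>[0, pi]\<close> because \<open>lam < 1\<close>. Hence the potential of
  \<open>m\<close> equally spaced points has its maxima exactly at the midpoints of the gaps
  (\<open>comb_max\<close>). By induction on \<open>n\<close>, the first \<open>2 ^ n\<close> points of a greedy sequence are equally
  spaced, and the points that follow lie in the gaps and themselves form a greedy sequence
  (\<open>greedy_second_block\<close>, \<open>greedy_dyadic_structure\<close>): the maximum of the sum of two potentials is the
  sum of their maxima as soon as both can be attained at a common point. Peeling off the blocks of sizes
  \<open>2 ^ e\<close> in the binary expansion of \<open>N\<close> expresses the energy of the first \<open>N\<close> points by the sums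
  \<open>S m = \<Sum>k<m. (2 sin (pi k / m)) powr lam\<close> with \<open>m\<close> a power of two (\<open>greedy_energy_binary\<close>).

  The sum \<open>S m\<close> is a trapezoidal rule for \<open>m * I_energy lam sigma1\<close>. Its error comes from the
  singularity \<open>x powr lam\<close> at both ends; after scaling by \<open>m powr lam\<close> the error on each cell converges
  to the error for \<open>x powr lam\<close>, and dominated convergence gives
  \<open>m powr lam * (S m - m * I) \<longlonglongrightarrow> (2 * pi) powr lam * 2 * \<zeta>(- lam)\<close> (\<open>comb_asymptotics\<close>). Here
  \<open>\<zeta>(- lam)\<close> is the sum of the trapezoidal errors of \<open>x powr lam\<close> on the unit intervals
  (\<open>riemann_zeta_neg\<close>), so it is negative. To identify it, the zeta function is
  continued to the whole plane through the alternating series, whose iterated Euler transforms converge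
  on ever larger half-planes (\<open>riemann_zeta_eq\<close>).

  Inserting the asymptotics in the energy formula shows that the normalised energy at \<open>N\<close> differs by a null
  sequence from \<open>C * G \<theta>\<close>, where \<open>C < 0\<close> is the zeta constant and \<open>\<theta>\<close> is the vector of the binary
  digits of \<open>N\<close> divided by \<open>N\<close> (\<open>normalized_energy_asymptotics\<close>). These vectors belong to the sets
  \<open>Theta p\<close>, on which \<open>G\<close> is continuous along the defining sequences (\<open>Theta_limit\<close>); all values
  \<open>C * G \<theta>\<close> are therefore limit points, and every limit point lies in their closure. The lower limit follows because
  \<open>C\<close> is negative. The upper limit needs \<open>G \<ge> 1\<close>, with equality at powers of two, which is once
  more an inequality about concave powers (\<open>block_scale_ge\<close>). Divergence follows from \<open>G > 1\<close> for the
  digits of 3.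
\<close>

section \<open>Analytic continuation of the zeta function\<close>

text \<open>Iterated forward differences of \<open>x powr (- s)\<close> in \<open>x\<close>. The variable \<open>x\<close> is real so that the mean value
  inequality applies to it.\<close>

primrec pow_diff :: "nat \<Rightarrow> complex \<Rightarrow> real \<Rightarrow> complex" where
  "pow_diff 0 s x = complex_of_real x powr (-s)"
| "pow_diff (Suc k) s x = pow_diff k s x - pow_diff k s (x + 1)"

lemma pow_diff_has_vector_derivative:
  assumes "x > 0"
  shows "(pow_diff k s has_vector_derivative (- s * pow_diff k (s + 1) x)) (at x within A)"
  using assms
proof (induction k arbitrary: x A)
  case 0
  have "((\<lambda>z. z powr (-s)) has_field_derivative (-s) * of_real x powr (-s - 1)) (at (complex_of_real x))"
    using 0 by (intro has_field_derivative_powr) (auto simp: complex_nonpos_Reals_iff)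
  from has_vector_derivative_real_field[OF this] show ?case
    by simp
next
  case (Suc k)
  have "((\<lambda>y. pow_diff k s (y + 1)) has_vector_derivative (- s * pow_diff k (s + 1) (x + 1))) (at x within A)"
  proof -
    have "((\<lambda>y::real. y + 1) has_vector_derivative 1) (at x within A)"
      by (auto intro!: derivative_eq_intros)
    from vector_diff_chain_within[OF this Suc.IH[of "x+1"]]
    show ?thesis using Suc.prems by (simp add: o_def)
  qed
  from has_vector_derivative_diff[OF Suc.IH[OF Suc.prems] this]
  show ?case by (simp add: algebra_simps)
qed

text \<open>Each difference gains one power of decay: by the mean value inequality a difference is bounded by the
  derivative, and differentiating \<open>x powr (- s)\<close> multiplies it by \<open>- s\<close> and raises the exponent by one. This is
  what makes the series of \<open>k\<close>-th differences converge for \<open>Re s > 1 - k\<close>.\<close>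

lemma norm_pow_diff_le:
  assumes "x > 0" "Re s + real k \<ge> 0"
  shows "norm (pow_diff k s x) \<le> norm (pochhammer s k) * x powr (-(Re s + real k))"
  using assms
proof (induction k arbitrary: s x)
  case 0
  then show ?case by (simp add: norm_powr_real_powr)
next
  case (Suc k)
  define B where "B = norm s * (norm (pochhammer (s + 1) k) * x powr (-(Re s + real (Suc k))))"
  have "norm (pow_diff k s (x+1) - pow_diff k s x) \<le> B * norm (x + 1 - x)"
  proof (rule differentiable_bound[of "{x..x+1}"])
    fix y assume y: "y \<in> {x..x+1}"
    show "(pow_diff k s has_derivative (\<lambda>h. h *\<^sub>R (- s * pow_diff k (s + 1) y))) (at y within {x..x+1})"
      using pow_diff_has_vector_derivative[of y k s "{x..x+1}"] y Suc.prems
      unfolding has_vector_derivative_def by auto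
    have "norm (pow_diff k (s + 1) y) \<le> norm (pochhammer (s + 1) k) * y powr (-(Re (s + 1) + real k))"
      using y Suc.prems by (intro Suc.IH) auto
    also have "\<dots> \<le> norm (pochhammer (s + 1) k) * x powr (-(Re s + real (Suc k)))"
      using y Suc.prems
      by (intro mult_left_mono) (auto simp: algebra_simps intro!: powr_mono2')
    finally have "norm (- s * pow_diff k (s + 1) y) \<le> B"
      unfolding B_def norm_mult norm_minus_cancel by (intro mult_left_mono) auto
    then show "onorm (\<lambda>h. h *\<^sub>R (- s * pow_diff k (s + 1) y)) \<le> B"
      by (intro onorm_le) (metis mult.commute mult_left_mono norm_ge_zero norm_scaleR real_norm_def)
  qed (use Suc.prems in auto)
  then show ?case
    by (simp add: B_def pochhammer_rec norm_mult mult.assoc norm_minus_commute)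
qed

lemma holomorphic_pow_diff: "x > 0 \<Longrightarrow> (\<lambda>s. pow_diff k s x) holomorphic_on A"
  by (induction k arbitrary: x) (auto intro!: holomorphic_intros)

text \<open>The alternating series \<open>\<Sum>n. (-1) ^ n / (n + 1) powr s\<close> after \<open>k\<close> applications of Euler's transformation
  \<open>\<Sum>n. (-1) ^ n * b n = b 0 / 2 + (\<Sum>n. (-1) ^ n * (b n - b (n + 1))) / 2\<close>.\<close>

definition eta_euler :: "nat \<Rightarrow> complex \<Rightarrow> complex" where
  "eta_euler k s = (\<Sum>j<k. pow_diff j s 1 / 2 ^ Suc j)
     + (\<Sum>n. (-1) ^ n * pow_diff k s (real (Suc n))) / 2 ^ k"

text \<open>Dirichlet's eta function on the whole plane; the number of Euler transformations is chosen large enough for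
  the series at \<open>s\<close> to converge.\<close>

definition eta :: "complex \<Rightarrow> complex" where
  "eta s = eta_euler (nat \<lceil>2 - Re s\<rceil>) s"

text \<open>A form of the bound that is uniform for bounded \<open>s\<close>, for the Weierstrass test.\<close>

lemma norm_pow_diff_le_uniform:
  assumes "M > 0" "norm s \<le> M" "Re s + real k \<ge> c" "c \<ge> 0"
  shows "norm ((-1) ^ n * pow_diff k s (real (Suc n))) \<le> pochhammer M k * real (Suc n) powr (-c)"
proof -
  have *: "norm (pochhammer s k) \<le> pochhammer M k"
  proof (induction k)
    case (Suc k)
    have "norm (s + of_nat k) \<le> M + real k"
      using norm_triangle_ineq[of s "of_nat k"] assms by simp
    then show ?case using Suc assms
      by (auto simp: pochhammer_Suc norm_mult intro!: mult_mono pochhammer_nonneg)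
  qed auto
  have "norm (pow_diff k s (real (Suc n))) \<le> norm (pochhammer s k) * real (Suc n) powr (-(Re s + real k))"
    using assms by (intro norm_pow_diff_le) auto
  also have "\<dots> \<le> pochhammer M k * real (Suc n) powr (-c)"
    using * assms by (intro mult_mono powr_mono) (auto intro: order_trans[OF _ *])
  finally show ?thesis by (simp add: norm_mult norm_power)
qed

lemma summable_Suc_powr: 
  assumes "c > 1" shows "summable (\<lambda>n. real (Suc n) powr (-c))"
  using summable_real_powr_iff[of "-c"] assms by (subst summable_Suc_iff) auto

lemma summable_eta_euler:
  assumes "Re s + real k > 1"
  shows "summable (\<lambda>n. (-1) ^ n * pow_diff k s (real (Suc n)))"
proof (rule summable_comparison_test')
  show "summable (\<lambda>n. pochhammer (norm s + 1) k * real (Suc n) powr (-(Re s + real k)))"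
    using assms by (intro summable_mult summable_Suc_powr)
  show "norm ((-1) ^ n * pow_diff k s (real (Suc n)))
      \<le> pochhammer (norm s + 1) k * real (Suc n) powr (-(Re s + real k))" for n
    using assms by (intro norm_pow_diff_le_uniform) (auto intro: add_nonneg_pos)
qed

lemma holomorphic_eta_euler: "eta_euler k holomorphic_on {s. Re s + real k > 1}"
proof -
  let ?S = "{s. Re s + real k > 1}"
  have "(\<lambda>s. \<Sum>n. (-1) ^ n * pow_diff k s (real (Suc n))) holomorphic_on ?S"
  proof (rule holomorphic_uniform_sequence)
    have "open {s. 1 - real k < Re s}"
      by (rule open_halfspace_Re_gt)
    then show "open ?S" by (simp add: algebra_simps)
    show "(\<lambda>s. \<Sum>n<N. (-1) ^ n * pow_diff k s (real (Suc n))) holomorphic_on ?S" for N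
      by (intro holomorphic_intros holomorphic_pow_diff) auto
    fix s assume s: "s \<in> ?S"
    define d where "d = (Re s + real k - 1) / 2"
    have d: "d > 0" using s by (auto simp: d_def)
    have Re: "Re z + real k \<ge> 1 + d" if "z \<in> cball s d" for z
    proof -
      have "\<bar>Re s - Re z\<bar> \<le> d"
        using that abs_Re_le_cmod[of "s - z"] by (simp add: dist_norm)
      then have "Re s - d \<le> Re z" by linarith
      then show ?thesis unfolding d_def by (simp add: field_simps)
    qed
    moreover have "uniform_limit (cball s d) (\<lambda>N z. \<Sum>n<N. (-1) ^ n * pow_diff k z (real (Suc n)))
        (\<lambda>z. \<Sum>n. (-1) ^ n * pow_diff k z (real (Suc n))) sequentially"
    proof (rule Weierstrass_m_test)
      show "summable (\<lambda>n. pochhammer (norm s + d) k * real (Suc n) powr (-(1 + d)))"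
        using d by (intro summable_mult summable_Suc_powr) auto
      fix n z assume z: "z \<in> cball s d"
      then have "norm z \<le> norm s + d"
        using norm_triangle_ineq2[of z s] by (simp add: dist_norm norm_minus_commute)
      then show "norm ((-1) ^ n * pow_diff k z (real (Suc n)))
          \<le> pochhammer (norm s + d) k * real (Suc n) powr (-(1 + d))"
        using d Re[OF z] by (intro norm_pow_diff_le_uniform) (auto intro: add_nonneg_pos)
    qed
    ultimately show "\<exists>d. 0 < d \<and> cball s d \<subseteq> ?S \<and>
        uniform_limit (cball s d) (\<lambda>N z. \<Sum>n<N. (-1) ^ n * pow_diff k z (real (Suc n)))
        (\<lambda>z. \<Sum>n. (-1) ^ n * pow_diff k z (real (Suc n))) sequentially"
      using d Re by (intro exI[of _ d] conjI subsetI) (auto intro: less_le_trans[of 1 "1 + d"])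
  qed
  then show ?thesis
    unfolding eta_euler_def by (intro holomorphic_intros holomorphic_pow_diff) auto
qed

lemma alternating_sum_by_parts:
  fixes b :: "nat \<Rightarrow> 'a :: field_char_0"
  shows "(\<Sum>n<N. (-1) ^ n * b n) = (b 0 - (-1) ^ N * b N) / 2 + (\<Sum>n<N. (-1) ^ n * (b n - b (Suc n))) / 2"
  by (induction N) (auto simp: field_simps)

lemma eta_euler_Suc:
  assumes "Re s + real k > 1"
  shows "eta_euler (Suc k) s = eta_euler k s"
proof -
  let ?b = "\<lambda>n. pow_diff k s (real (Suc n))"
  have sm: "summable (\<lambda>n. (-1) ^ n * ?b n)" "summable (\<lambda>n. (-1) ^ n * pow_diff (Suc k) s (real (Suc n)))"
    using assms summable_eta_euler[of s k] summable_eta_euler[of s "Suc k"] by simp_all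
  have "(\<lambda>N. \<Sum>n<N. (-1) ^ n * ?b n) \<longlonglongrightarrow> (?b 0 - 0) / 2
      + (\<Sum>n. (-1) ^ n * pow_diff (Suc k) s (real (Suc n))) / 2"
  proof -
    have "(\<lambda>N. \<Sum>n<N. (-1) ^ n * (?b n - ?b (Suc n)))
        \<longlonglongrightarrow> (\<Sum>n. (-1) ^ n * pow_diff (Suc k) s (real (Suc n)))"
      using summable_LIMSEQ[OF sm(2)] by (simp add: add.commute)
    then show ?thesis
      unfolding alternating_sum_by_parts[of ?b]
      by (intro tendsto_add tendsto_divide tendsto_diff tendsto_const summable_LIMSEQ_zero[OF sm(1)]) auto
  qed
  from LIMSEQ_unique[OF summable_LIMSEQ[OF sm(1)] this]
  have "(\<Sum>n. (-1) ^ n * ?b n)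
      = (?b 0 + (\<Sum>n. (-1) ^ n * pow_diff (Suc k) s (real (Suc n)))) / 2"
    by (simp add: add_divide_distrib)
  then have "(\<Sum>n. (-1) ^ n * ?b n) / 2 ^ k
      = pow_diff k s 1 / 2 ^ Suc k + (\<Sum>n. (-1) ^ n * pow_diff (Suc k) s (real (Suc n))) / 2 ^ Suc k"
    by (simp only: add_divide_distrib divide_divide_eq_left power_Suc) simp
  then show ?thesis
    unfolding eta_euler_def by (simp only: sum.lessThan_Suc add.assoc)
qed

lemma eta_eq_eta_euler:
  assumes "Re s + real k > 1"
  shows "eta s = eta_euler k s"
proof -
  have *: "eta_euler (k + j) s = eta_euler k s" if "Re s + real k > 1" for j k
    using that by (induction j) (auto simp: eta_euler_Suc)
  let ?k = "nat \<lceil>2 - Re s\<rceil>"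
  have "2 - Re s \<le> real ?k" by linarith
  then have "Re s + real ?k > 1" by linarith
  from *[OF this, of k] *[OF assms, of ?k] show ?thesis
    unfolding eta_def add.commute[of k ?k] by (rule trans[OF sym])
qed

lemma holomorphic_eta: "eta holomorphic_on UNIV"
proof -
  have "eta analytic_on {s}" for s
  proof -
    obtain k :: nat where k: "1 - Re s < real k"
      using reals_Archimedean2 by blast
    let ?S = "{s. 1 - real k < Re s}"
    have "?S = {s. Re s + real k > 1}" by auto
    then have "eta_euler k holomorphic_on ?S"
      using holomorphic_eta_euler by simp
    then have "eta holomorphic_on ?S"
      by (rule holomorphic_transform) (subst eta_eq_eta_euler[of _ k], auto)
    moreover have "open ?S" "s \<in> ?S"
      using k by (auto intro: open_halfspace_Re_gt)
    ultimately show ?thesis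
      unfolding analytic_at by (intro exI[of _ ?S] conjI)
  qed
  then have "eta analytic_on UNIV"
    using analytic_on_analytic_at by blast
  then show ?thesis
    by (rule analytic_imp_holomorphic)
qed

text \<open>The alternating series is the full series minus twice its even terms, which make up \<open>2 powr (- s)\<close> times the
  full series.\<close>

lemma eta_dirichlet:
  assumes "Re s > 1" and "(\<lambda>n. 1 / of_nat (Suc n) powr s) sums z"
  shows "eta s = (1 - 2 powr (1 - s)) * z"
proof -
  let ?a = "\<lambda>n. 1 / of_nat (Suc n) powr s :: complex"
  have "(\<lambda>N. \<Sum>n<2*N. (-1) ^ n * ?a n) \<longlonglongrightarrow> eta s"
  proof -
    have *: "(\<lambda>n. (-1) ^ n * pow_diff 0 s (real (Suc n))) = (\<lambda>n. (-1) ^ n * ?a n)"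
      by (simp add: powr_minus divide_inverse)
    have "summable (\<lambda>n. (-1) ^ n * ?a n)"
      using summable_eta_euler[of s 0] assms(1) unfolding * by simp
    moreover have "eta s = (\<Sum>n. (-1) ^ n * ?a n)"
      using eta_eq_eta_euler[of s 0] assms(1) * by (simp add: eta_euler_def)
    ultimately have "(\<lambda>N. \<Sum>n<N. (-1) ^ n * ?a n) \<longlonglongrightarrow> eta s"
      by (simp add: summable_LIMSEQ)
    then show ?thesis
      by (rule LIMSEQ_subseq_LIMSEQ[unfolded o_def]) (auto simp: strict_mono_def)
  qed
  note lim1 = this
  have lim2: "(\<lambda>N. (\<Sum>n<2*N. ?a n) - 2 powr (1 - s) * (\<Sum>n<N. ?a n)) \<longlonglongrightarrow> z - 2 powr (1 - s) * z"
  proof (intro tendsto_intros)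
    show "(\<lambda>N. \<Sum>n<N. ?a n) \<longlonglongrightarrow> z" using assms(2) by (simp add: sums_def)
    then show "(\<lambda>N. \<Sum>n<2*N. ?a n) \<longlonglongrightarrow> z"
      by (rule LIMSEQ_subseq_LIMSEQ[unfolded o_def]) (auto simp: strict_mono_def)
  qed
  have eq: "(\<Sum>n<2*N. (-1) ^ n * ?a n) = (\<Sum>n<2*N. ?a n) - 2 powr (1 - s) * (\<Sum>n<N. ?a n)" for N
  proof (induction N)
    case (Suc N)
    have "of_nat (2 + 2 * N) powr s = (of_real 2 * of_real (real (Suc N))) powr s"
      by simp
    also have "\<dots> = 2 powr s * of_nat (Suc N) powr s"
      by (subst powr_times_real) auto
    finally have "of_nat (2 + 2 * N) powr s = 2 powr s * of_nat (Suc N) powr s" .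
    then have "2 / of_nat (2 + 2 * N) powr s = 2 powr (1 - s) * ?a N"
      by (simp add: powr_diff)
    with Suc show ?case by (simp add: algebra_simps)
  qed simp
  have "eta s = z - 2 powr (1 - s) * z"
    using LIMSEQ_unique[OF lim1[unfolded eq] lim2] .
  then show ?thesis
    by (simp add: algebra_simps)
qed

text \<open>The identity theorem. The difference of two such functions need not be normalised at its singularities,
  so it is normalised first; being zero, it shows that the two functions agree near every point, and there the
  normalisation (limit value, or \<open>0\<close> at a pole) determines the value.\<close>

lemma nicely_meromorphic_eq_extend:
  assumes f: "f nicely_meromorphic_on UNIV" and g: "g nicely_meromorphic_on UNIV"
    and eq: "\<And>s. s \<in> A \<Longrightarrow> f s = g s" and A: "open A" "A \<noteq> {}"
  shows "f = g"
proof -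
  let ?h = "remove_sings (\<lambda>s. f s - g s)"
  have mer: "(\<lambda>s. f s - g s) meromorphic_on UNIV"
    using f g unfolding nicely_meromorphic_on_def by (auto intro!: meromorphic_intros)
  have h: "?h nicely_meromorphic_on UNIV"
    using mer by (rule remove_sings_nicely_meromorphic)
  have h0: "?h s = 0" if "s \<in> A" for s
  proof (rule remove_sings_eqI)
    have "eventually (\<lambda>z. z \<in> A - {s}) (at s)"
      using A(1) that by (intro eventually_at_in_open)
    then have "\<forall>\<^sub>F z in at s. f z - g z = 0" by eventually_elim (auto simp: eq)
    then show "(\<lambda>s. f s - g s) \<midarrow>s\<rightarrow> 0" by (simp add: tendsto_eventually)
  qed
  have "?h constant_on UNIV"
    by (rule constant_on_extend_nicely_meromorphic_on[OF h, of A])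
       (use A h0 in \<open>auto simp: constant_on_def\<close>)
  with h0 A have zero: "?h s = 0" for s
    by (force simp: constant_on_def)
  show ?thesis
  proof
    fix z
    have "(\<lambda>s. f s - g s) meromorphic_on {z}"
      using mer meromorphic_on_subset by blast
    then have "\<forall>\<^sub>F s in at z. ?h s = f s - g s"
      by (intro eventually_remove_sings_eq_at)
         (auto simp: meromorphic_on_def intro: has_laurent_expansion_isolated)
    then have ev: "\<forall>\<^sub>F s in at z. f s = g s"
      by eventually_elim (simp add: zero)
    have pole: "is_pole f z \<longleftrightarrow> is_pole g z"
      by (intro is_pole_cong ev refl)
    have lim: "f \<midarrow>z\<rightarrow> c \<longleftrightarrow> g \<midarrow>z\<rightarrow> c" for c
      by (intro tendsto_cong ev)
    have "(is_pole f z \<and> f z = 0) \<or> f \<midarrow>z\<rightarrow> f z"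
      using f unfolding nicely_meromorphic_on_def by blast
    moreover have "(is_pole g z \<and> g z = 0) \<or> g \<midarrow>z\<rightarrow> g z"
      using g unfolding nicely_meromorphic_on_def by blast
    moreover have "\<not> (is_pole f z \<and> f \<midarrow>z\<rightarrow> c)" for c
      using not_tendsto_and_filterlim_at_infinity[of "at z" f c] by (auto simp: is_pole_def)
    ultimately show "f z = g z"
      using pole lim LIM_unique[of f "f z" z "g z"] by metis
  qed
qed

text \<open>With its removable singularities removed, the quotient satisfies the two conditions that characterise \<^const>\<open>riemann_zeta\<close>.\<close>

theorem riemann_zeta_eq:
  assumes "2 powr (1 - s) \<noteq> 1"
  shows "riemann_zeta s = eta s / (1 - 2 powr (1 - s))"
proof -
  let ?q = "\<lambda>s. eta s / (1 - 2 powr (1 - s))"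
  define Z where "Z = remove_sings ?q"
  have den: "(\<lambda>s::complex. 1 - 2 powr (1 - s)) holomorphic_on UNIV"
    by (auto intro!: holomorphic_intros)
  have mer: "?q meromorphic_on UNIV"
    using holomorphic_eta den
    by (intro meromorphic_on_divide analytic_on_imp_meromorphic_on) (simp_all only: analytic_on_open open_UNIV)
  have Zq: "Z s = ?q s" if "2 powr (1 - s) \<noteq> 1" for s
  proof -
    have "eta analytic_on {s}" "(\<lambda>s::complex. 1 - 2 powr (1 - s)) analytic_on {s}"
      using holomorphic_eta den by (auto simp only: analytic_at intro: open_UNIV)
    then have "?q analytic_on {s}"
      using that by (intro analytic_on_divide) simp_all
    then show ?thesis unfolding Z_def by simp
  qed
  have *: "riemann_zeta = Z"
    unfolding riemann_zeta_def
  proof (rule the_equality, safe)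
    show "Z nicely_meromorphic_on UNIV"
      unfolding Z_def by (rule remove_sings_nicely_meromorphic[OF mer])
    fix s :: complex assume s: "Re s > 1"
    have "norm (2 powr (1 - s) :: complex) = 2 powr (1 - Re s)"
      using norm_powr_real_powr[of 2 "1 - s"] by simp
    also have "\<dots> < 2 powr 0" using s by (intro powr_less_mono) auto
    finally have ne: "2 powr (1 - s) \<noteq> (1 :: complex)" by auto
    have "summable (\<lambda>n. 1 / of_nat (Suc n) powr s :: complex)"
    proof (rule summable_comparison_test'[OF summable_Suc_powr[OF s], where N = 0])
      show "norm (1 / of_nat (Suc n) powr s :: complex) \<le> real (Suc n) powr (- Re s)" for n
        using norm_powr_real_powr[of "of_nat (Suc n)" s]
        by (simp add: norm_divide norm_inverse powr_minus divide_inverse del: of_nat_Suc)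
    qed
    then have sums: "(\<lambda>n. 1 / of_nat (Suc n) powr s :: complex) sums (\<Sum>n. 1 / of_nat (Suc n) powr s)"
      by (rule summable_sums)
    have "Z s = (\<Sum>n. 1 / of_nat (Suc n) powr s)"
      unfolding Zq[OF ne] eta_dirichlet[OF s sums] using ne by simp
    with sums show "(\<lambda>n. 1 / of_nat (Suc n) powr s) sums Z s" by (simp only:)
  next
    fix f assume f: "f nicely_meromorphic_on UNIV"
      and fs: "\<forall>s. Re s > 1 \<longrightarrow> (\<lambda>n. 1 / of_nat (Suc n) powr s) sums f s"
    show "f = Z"
    proof (rule nicely_meromorphic_eq_extend[OF f])
      show "Z nicely_meromorphic_on UNIV"
        unfolding Z_def by (rule remove_sings_nicely_meromorphic[OF mer])
      show "open {s. Re s > 1}" by (rule open_halfspace_Re_gt)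
      have "2 \<in> {s. Re s > 1}" by simp
      then show "{s. Re s > 1} \<noteq> {}" by blast
      fix s assume "s \<in> {s. Re s > 1}"
      then have s: "Re s > 1" by simp
      have "norm (2 powr (1 - s) :: complex) = 2 powr (1 - Re s)"
        using norm_powr_real_powr[of 2 "1 - s"] by simp
      also have "\<dots> < 2 powr 0" using s by (intro powr_less_mono) auto
      finally have ne: "2 powr (1 - s) \<noteq> (1 :: complex)" by auto
      have "eta s = (1 - 2 powr (1 - s)) * f s"
        using fs s by (intro eta_dirichlet[OF s]) simp
      then show "f s = Z s"
        unfolding Zq[OF ne] using ne by simp
    qed
  qed
  show ?thesis unfolding * by (rule Zq[OF assms])
qed

section \<open>The zeta function at negative arguments as a sum of trapezoidal errors\<close>

text \<open>As a function of the step \<open>h\<close>, the trapezoidal error on \<open>[a, a + h]\<close> vanishes to second order at \<open>0\<close> and has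
  second derivative \<open>h * f'' (a + h) / 2\<close>. One-sided bounds on \<open>f''\<close> thus carry over, with their sign.\<close>

lemma trapezoid_error_bounds:
  fixes f f' f'' P :: "real \<Rightarrow> real"
  assumes P: "\<And>x. a \<le> x \<Longrightarrow> x \<le> a + 1 \<Longrightarrow> (P has_real_derivative f x) (at x)"
    and f: "\<And>x. a \<le> x \<Longrightarrow> x \<le> a + 1 \<Longrightarrow> (f has_real_derivative f' x) (at x)"
    and f': "\<And>x. a \<le> x \<Longrightarrow> x \<le> a + 1 \<Longrightarrow> (f' has_real_derivative f'' x) (at x)"
    and bounds: "\<And>x. a \<le> x \<Longrightarrow> x \<le> a + 1 \<Longrightarrow> L \<le> f'' x \<and> f'' x \<le> U" and LU: "L \<le> 0" "0 \<le> U"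
  shows "L / 2 \<le> (f a + f (a + 1)) / 2 - (P (a + 1) - P a)"
    and "(f a + f (a + 1)) / 2 - (P (a + 1) - P a) \<le> U / 2"
proof -
  \<comment> \<open>\<open>\<psi> h\<close> is the trapezoidal error on \<open>[a, a + h]\<close>, and \<open>h \<mapsto> \<psi>' h\<close> its derivative.\<close>
  define \<psi> where "\<psi> h = h * (f a + f (a + h)) / 2 - (P (a + h) - P a)" for h
  define \<psi>' where "\<psi>' h = (f a - f (a + h)) / 2 + h * f' (a + h) / 2" for h
  have shift: "((\<lambda>h. g (a + h)) has_real_derivative g' (a + h)) (at h)"
    if "\<And>x. a \<le> x \<Longrightarrow> x \<le> a + 1 \<Longrightarrow> (g has_real_derivative g' x) (at x)" "0 \<le> h" "h \<le> 1" for g g' h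
    using that(1)[of "h + a"] that(2,3) by (simp add: DERIV_shift[of g _ h a] add.commute[of a])
  have d1: "(\<psi> has_real_derivative \<psi>' h) (at h)" if "0 \<le> h" "h \<le> 1" for h
    unfolding \<psi>_def \<psi>'_def
    by (rule derivative_eq_intros refl shift[OF P that] shift[OF f that] | simp)+
       (simp add: field_simps)
  have d2: "(\<psi>' has_real_derivative h * f'' (a + h) / 2) (at h)" if "0 \<le> h" "h \<le> 1" for h
    unfolding \<psi>'_def
    by (rule derivative_eq_intros refl shift[OF f that] shift[OF f' that] | simp)+
       (simp add: field_simps)
  have b2: "L / 2 \<le> h * f'' (a + h) / 2 \<and> h * f'' (a + h) / 2 \<le> U / 2" if "0 \<le> h" "h \<le> 1" for h
  proof -
    have "h * f'' (a + h) \<le> 1 * U" "h * L \<le> h * f'' (a + h)"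
      using bounds[of "a + h"] that LU mult_mono'[of h 1 "max 0 (f'' (a+h))" U] mult_left_mono[of "f'' (a+h)" "max 0 (f'' (a+h))" h]
      by (auto intro: mult_left_mono)
    moreover have "1 * L \<le> h * L" using that LU by (intro mult_right_mono_neg) auto
    ultimately show ?thesis by simp
  qed
  have b1: "L / 2 \<le> \<psi>' h \<and> \<psi>' h \<le> U / 2" if "0 \<le> h" "h \<le> 1" for h
  proof (cases "h = 0")
    case False
    have "\<exists>z>0. z < h \<and> \<psi>' h - \<psi>' 0 = (h - 0) * (z * f'' (a + z) / 2)"
      by (rule MVT2) (use False that d2 in auto)
    then obtain z where z: "0 < z" "z < h" "\<psi>' h - \<psi>' 0 = (h - 0) * (z * f'' (a + z) / 2)"
      by blast
    have "h * (L / 2) \<le> h * (z * f'' (a + z) / 2)" "h * (z * f'' (a + z) / 2) \<le> h * (U / 2)"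
      using b2[of z] z that by (intro mult_left_mono; simp)+
    moreover have "h * (U / 2) \<le> 1 * (U / 2)" "1 * (L / 2) \<le> h * (L / 2)"
      using that LU by (intro mult_right_mono mult_right_mono_neg; simp)+
    ultimately show ?thesis using z(3) by (simp add: \<psi>'_def)
  qed (use LU in \<open>simp add: \<psi>'_def\<close>)
  obtain z where z: "0 < z" "z < 1" "\<psi> 1 - \<psi> 0 = (1 - 0) * \<psi>' z"
    using MVT2[of 0 1 \<psi> \<psi>'] d1 by auto
  then have "\<psi> 1 = \<psi>' z" by (simp add: \<psi>_def)
  then show "L / 2 \<le> (f a + f (a + 1)) / 2 - (P (a + 1) - P a)"
    and "(f a + f (a + 1)) / 2 - (P (a + 1) - P a) \<le> U / 2"
    using b1[of z] z by (simp_all add: \<psi>_def)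
qed

definition powr_trapezoid_error :: "real \<Rightarrow> nat \<Rightarrow> real" where
  "powr_trapezoid_error lam k = (real k powr lam + real (Suc k) powr lam) / 2
     - (real (Suc k) powr (lam + 1) - real k powr (lam + 1)) / (lam + 1)"

lemma powr_trapezoid_error_bounds:
  assumes "0 < lam" "lam < 1" "k \<ge> 1"
  shows "powr_trapezoid_error lam k \<le> 0" "\<bar>powr_trapezoid_error lam k\<bar> \<le> real k powr (lam - 2)"
proof -
  let ?f'' = "\<lambda>x. lam * ((lam - 1) * x powr (lam - 2))"
  define L where "L = ?f'' (real k)"
  have L: "L \<le> 0" using assms unfolding L_def by (intro mult_nonneg_nonpos mult_nonpos_nonneg) auto
  have d: "((\<lambda>x. x powr (lam + 1) / (lam + 1)) has_real_derivative x powr lam) (at x)"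
    "((\<lambda>x. x powr lam) has_real_derivative lam * x powr (lam - 1)) (at x)"
    "((\<lambda>x. lam * x powr (lam - 1)) has_real_derivative ?f'' x) (at x)" if "real k \<le> x" for x
    using that assms by (auto intro!: derivative_eq_intros)
  have b: "L \<le> ?f'' x \<and> ?f'' x \<le> 0" if "real k \<le> x" for x
  proof -
    have "x powr (lam - 2) \<le> real k powr (lam - 2)"
      using that assms by (intro powr_mono2') auto
    then have "(lam * (lam - 1)) * real k powr (lam - 2) \<le> (lam * (lam - 1)) * x powr (lam - 2)"
      using assms by (intro mult_left_mono_neg) (auto intro: mult_nonneg_nonpos)
    then show ?thesis
      unfolding L_def using assms mult_nonneg_nonpos[of lam "(lam - 1) * x powr (lam - 2)"]
        mult_nonpos_nonneg[of "lam - 1" "x powr (lam - 2)"]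
      by (simp add: mult.assoc)
  qed
  note * = trapezoid_error_bounds[of "real k" "\<lambda>x. x powr (lam + 1) / (lam + 1)" "\<lambda>x. x powr lam"
      "\<lambda>x. lam * x powr (lam - 1)" ?f'' L 0, OF d(1) d(2) d(3) b L order.refl]
  have "powr_trapezoid_error lam k \<le> 0" "L / 2 \<le> powr_trapezoid_error lam k"
    using * by (simp_all add: powr_trapezoid_error_def add.commute diff_divide_distrib)
  moreover have "- L \<le> real k powr (lam - 2)"
  proof -
    have "lam * (1 - lam) \<le> 1 * 1" using assms by (intro mult_mono) auto
    then have "lam * (1 - lam) * real k powr (lam - 2) \<le> 1 * real k powr (lam - 2)"
      by (intro mult_right_mono) auto
    then show ?thesis by (simp add: L_def algebra_simps)
  qed
  ultimately show "powr_trapezoid_error lam k \<le> 0" "\<bar>powr_trapezoid_error lam k\<bar> \<le> real k powr (lam - 2)"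
    using L by auto
qed

lemma summable_powr_trapezoid_error:
  assumes "0 < lam" "lam < 1"
  shows "summable (powr_trapezoid_error lam)"
proof (rule summable_comparison_test')
  show "summable (\<lambda>k. real k powr (lam - 2))"
    using assms by (simp only: summable_real_powr_iff)
  show "norm (powr_trapezoid_error lam k) \<le> real k powr (lam - 2)" if "1 \<le> k" for k
    unfolding real_norm_def by (rule powr_trapezoid_error_bounds(2)[OF assms that])
qed

text \<open>The trapezoidal rule underestimates the integral of a concave function.\<close>

lemma suminf_powr_trapezoid_error_neg:
  assumes "0 < lam" "lam < 1"
  shows "(\<Sum>k. powr_trapezoid_error lam k) < 0"
proof -
  have "(\<Sum>k. powr_trapezoid_error lam k) = (\<Sum>k. powr_trapezoid_error lam (Suc k)) + powr_trapezoid_error lam 0"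
    using suminf_split_head[OF summable_powr_trapezoid_error[OF assms]] by linarith
  moreover have "(\<Sum>k. powr_trapezoid_error lam (Suc k)) \<le> 0"
  proof -
    have "summable (\<lambda>k. powr_trapezoid_error lam (Suc k))"
      using summable_powr_trapezoid_error[OF assms] by (subst summable_Suc_iff)
    then have "(\<Sum>k. powr_trapezoid_error lam (Suc k)) \<le> (\<Sum>k::nat. 0)"
      using powr_trapezoid_error_bounds(1)[OF assms] by (intro suminf_le) auto
    then show ?thesis by simp
  qed
  moreover have "powr_trapezoid_error lam 0 < 0"
    using assms by (simp add: powr_trapezoid_error_def field_simps)
  ultimately show ?thesis by linarith
qed

lemma sum_powr_trapezoid_error:
  assumes "0 < lam"
  shows "(\<Sum>k<M. powr_trapezoid_error lam k)
    = (\<Sum>k<M. real (Suc k) powr lam) - real M powr lam / 2 - real M powr (lam + 1) / (lam + 1)"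
proof (induction M)
  case 0
  then show ?case using assms by simp
next
  case (Suc M)
  have "powr_trapezoid_error lam M = real (Suc M) powr lam - (real (Suc M) powr lam - real M powr lam) / 2
      - (real (Suc M) powr (lam + 1) / (lam + 1) - real M powr (lam + 1) / (lam + 1))"
    unfolding powr_trapezoid_error_def diff_divide_distrib add_divide_distrib by simp
  then show ?case
    unfolding sum.lessThan_Suc Suc.IH by (simp only: diff_divide_distrib)
qed

text \<open>Two Euler transformations converge for \<open>Re s > -1\<close>. Undoing them on partial sums shows that the alternating
  series itself, with half of the next term added, converges there.\<close>

lemma eta_averaged_limit:
  assumes "Re s > -1"
  shows "(\<lambda>N. (\<Sum>n<N. (-1) ^ n * pow_diff 0 s (real (Suc n))) + (-1) ^ N * pow_diff 0 s (real (Suc N)) / 2)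
    \<longlonglongrightarrow> eta s"
proof -
  let ?b = "\<lambda>k n. pow_diff k s (real (Suc n))"
  have diff: "?b k n - ?b k (Suc n) = ?b (Suc k) n" for k n
    by (simp add: add.commute)
  have sm: "summable (\<lambda>n. (-1) ^ n * ?b 2 n)"
    using summable_eta_euler[of s 2] assms by simp
  have null: "(\<lambda>N. (-1) ^ N * ?b 1 N) \<longlonglongrightarrow> 0"
  proof (rule Lim_null_comparison)
    have "(\<lambda>N. real (Suc N) powr (-(Re s + 1))) \<longlonglongrightarrow> 0"
      using assms filterlim_compose[OF filterlim_real_sequentially filterlim_Suc]
      by (intro tendsto_neg_powr) auto
    then show "(\<lambda>N. pochhammer (norm s + 1) 1 * real (Suc N) powr (-(Re s + 1))) \<longlonglongrightarrow> 0"
      by (rule tendsto_mult_right_zero)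
    show "\<forall>\<^sub>F N in sequentially. norm ((-1) ^ N * ?b 1 N)
        \<le> pochhammer (norm s + 1) 1 * real (Suc N) powr (-(Re s + 1))"
      using assms by (intro always_eventually allI norm_pow_diff_le_uniform) (auto intro: add_nonneg_pos)
  qed
  have "(\<Sum>n<N. (-1) ^ n * ?b 0 n) + (-1) ^ N * ?b 0 N / 2
      = ?b 0 0 / 2 + (?b 1 0 - (-1) ^ N * ?b 1 N) / 4 + (\<Sum>n<N. (-1) ^ n * ?b 2 n) / 4" for N
    unfolding alternating_sum_by_parts[of "?b 0" N] diff
    unfolding alternating_sum_by_parts[of "?b (Suc 0)" N] diff
    by (simp add: field_simps numeral_2_eq_2 del: pow_diff.simps)
  moreover have "(\<lambda>N. ?b 0 0 / 2 + (?b 1 0 - (-1) ^ N * ?b 1 N) / 4 + (\<Sum>n<N. (-1) ^ n * ?b 2 n) / 4)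
      \<longlonglongrightarrow> ?b 0 0 / 2 + (?b 1 0 - 0) / 4 + (\<Sum>n. (-1) ^ n * ?b 2 n) / 4"
    by (intro tendsto_add tendsto_divide tendsto_diff tendsto_const null summable_LIMSEQ[OF sm]) auto
  moreover have "?b 0 0 / 2 + (?b 1 0 - 0) / 4 + (\<Sum>n. (-1) ^ n * ?b 2 n) / 4 = eta s"
    using eta_eq_eta_euler[of s 2] assms
    by (simp add: eta_euler_def numeral_2_eq_2 del: pow_diff.simps)
  ultimately show ?thesis by simp
qed

text \<open>The partial sums \<open>T M\<close> of the errors equal \<open>\<Sum>k<M. (k + 1) powr lam\<close> up to explicit powers of \<open>M\<close>. In the
  combination \<open>T (2 * M) - 2 powr (1 + lam) * T M\<close> these powers nearly cancel and the alternating sum remains,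
  so its limit is on the one hand \<open>(1 - 2 powr (1 + lam))\<close> times the sum of the errors and on the other hand
  \<open>eta (- lam)\<close>.\<close>

theorem riemann_zeta_neg:
  assumes "0 < lam" "lam < 1"
  shows "Re (riemann_zeta (complex_of_real (-lam))) = (\<Sum>k. powr_trapezoid_error lam k)"
proof -
  define Z where "Z = (\<Sum>k. powr_trapezoid_error lam k)"
  define T where "T M = (\<Sum>k<M. powr_trapezoid_error lam k)" for M
  define s where "s = complex_of_real (-lam)"
  have Re_s: "Re s = -lam" and norm_s: "norm s = lam"
    using assms by (simp_all add: s_def)
  have T: "T \<longlonglongrightarrow> Z"
    unfolding T_def Z_def using summable_powr_trapezoid_error[OF assms] by (rule summable_LIMSEQ)
  have T2: "(\<lambda>M. T (2 * M)) \<longlonglongrightarrow> Z"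
    by (rule LIMSEQ_subseq_LIMSEQ[OF T, unfolded o_def]) (auto simp: strict_mono_def)
  have pd: "pow_diff 0 s x = complex_of_real (x powr lam)" if "x \<ge> 0" for x
    using that by (simp add: s_def powr_of_real)
  have pd1: "pow_diff 1 s x = complex_of_real (x powr lam - (x + 1) powr lam)" if "x > 0" for x
    using pd[of x] pd[of "x + 1"] that by simp
  have "(\<lambda>N. (\<Sum>n<2*N. (-1) ^ n * pow_diff 0 s (real (Suc n))) + (-1) ^ (2*N) * pow_diff 0 s (real (Suc (2*N))) / 2)
      \<longlonglongrightarrow> eta s"
    by (rule LIMSEQ_subseq_LIMSEQ[OF eta_averaged_limit, unfolded o_def])
       (use assms Re_s in \<open>auto simp: strict_mono_def\<close>)
  also have "(\<lambda>N. (\<Sum>n<2*N. (-1) ^ n * pow_diff 0 s (real (Suc n))) + (-1) ^ (2*N) * pow_diff 0 s (real (Suc (2*N))) / 2)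
      = (\<lambda>N. complex_of_real ((\<Sum>n<2*N. (-1) ^ n * real (Suc n) powr lam) + real (Suc (2*N)) powr lam / 2))"
    by (simp only: pd of_nat_0_le_iff of_real_add of_real_sum of_real_mult of_real_power of_real_minus
        of_real_1 of_real_divide of_real_numeral power_mult power2_minus power_one mult_1_left)
  also have "(\<lambda>N. (\<Sum>n<2*N. (-1) ^ n * real (Suc n) powr lam) + real (Suc (2*N)) powr lam / 2)
      = (\<lambda>N. T (2 * N) - 2 powr (1 + lam) * T N + (real (Suc (2*N)) powr lam - real (2*N) powr lam) / 2)"
  proof
    fix N
    have "(\<Sum>n<2*N. (-1) ^ n * real (Suc n) powr lam)
        = (\<Sum>n<2*N. real (Suc n) powr lam) - 2 powr (1 + lam) * (\<Sum>n<N. real (Suc n) powr lam)"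
    proof (induction N)
      case (Suc N)
      have "real (2 + 2 * N) powr lam = (2 * real (Suc N)) powr lam" by simp
      also have "\<dots> = 2 powr lam * real (Suc N) powr lam" by (rule powr_mult)
      finally show ?case using Suc by (simp add: algebra_simps powr_add)
    qed simp
    moreover have "real (2 * N) powr lam = 2 powr lam * real N powr lam"
      "real (2 * N) powr (lam + 1) = 2 powr (1 + lam) * real N powr (lam + 1)"
      by (simp_all add: powr_mult add.commute)
    ultimately show "(\<Sum>n<2*N. (-1) ^ n * real (Suc n) powr lam) + real (Suc (2*N)) powr lam / 2
      = T (2 * N) - 2 powr (1 + lam) * T N + (real (Suc (2*N)) powr lam - real (2*N) powr lam) / 2"
      unfolding T_def sum_powr_trapezoid_error[OF assms(1)]
      by (simp add: powr_add right_diff_distrib diff_divide_distrib)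
  qed
  finally have lim: "(\<lambda>N. complex_of_real (T (2 * N) - 2 powr (1 + lam) * T N
      + (real (Suc (2*N)) powr lam - real (2*N) powr lam) / 2)) \<longlonglongrightarrow> eta s" .
  have "(\<lambda>N. real (Suc (2*N)) powr lam - real (2*N) powr lam) \<longlonglongrightarrow> 0"
  proof (rule Lim_null_comparison)
    have "(\<lambda>N. real (2*N) powr (-(1 - lam))) \<longlonglongrightarrow> 0"
      using assms
      by (intro tendsto_neg_powr filterlim_compose[OF filterlim_real_sequentially] filterlim_subseq)
         (auto simp: strict_mono_def)
    then show "(\<lambda>N. lam * real (2*N) powr (-(1 - lam))) \<longlonglongrightarrow> 0"
      by (rule tendsto_mult_right_zero)
    have "norm (real (Suc (2*N)) powr lam - real (2*N) powr lam) \<le> lam * real (2*N) powr (-(1 - lam))"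
      if "N \<ge> 1" for N
    proof -
      have "norm (pow_diff 1 s (real (2*N))) \<le> norm (pochhammer s 1) * real (2*N) powr (-(Re s + real 1))"
        using that assms Re_s by (intro norm_pow_diff_le) auto
      then show ?thesis
        using that assms by (subst (asm) pd1) (simp_all add: norm_of_real Re_s norm_s abs_minus_commute add.commute del: of_real_diff)
    qed
    then show "\<forall>\<^sub>F N in sequentially. norm (real (Suc (2*N)) powr lam - real (2*N) powr lam) \<le> lam * real (2*N) powr (-(1 - lam))"
      unfolding eventually_sequentially by blast
  qed
  then have "(\<lambda>N. complex_of_real (T (2 * N) - 2 powr (1 + lam) * T N
      + (real (Suc (2*N)) powr lam - real (2*N) powr lam) / 2)) \<longlonglongrightarrow> complex_of_real (Z - 2 powr (1 + lam) * Z + 0 / 2)"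
    by (intro tendsto_of_real tendsto_add tendsto_diff tendsto_mult tendsto_divide tendsto_const T T2) auto
  from LIMSEQ_unique[OF lim this]
  have "eta s = complex_of_real ((1 - 2 powr (1 + lam)) * Z)" by (simp add: algebra_simps)
  moreover have pw: "2 powr (1 - s) = complex_of_real (2 powr (1 + lam))"
    using powr_of_real[of 2 "1 + lam"] by (simp add: s_def)
  moreover have gt: "2 powr (1 + lam) > 1" using assms by simp
  moreover have "2 powr (1 - s) \<noteq> 1"
    unfolding pw of_real_eq_1_iff using gt by linarith
  then have "riemann_zeta s = eta s / (1 - 2 powr (1 - s))"
    by (rule riemann_zeta_eq)
  ultimately have "riemann_zeta s = complex_of_real ((1 - 2 powr (1 + lam)) * Z / (1 - 2 powr (1 + lam)))"
    by (simp only: pw of_real_divide of_real_diff of_real_1)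
  then show ?thesis using gt assms by (simp add: Z_def s_def)
qed

section \<open>Greedy sequences and equally spaced points\<close>

text \<open>The kernel in half-angles: \<open>chord lam (x - y)\<close> is the \<open>lam\<close>-th power of the distance of \<open>cis (2 * x)\<close> and
  \<open>cis (2 * y)\<close>. The period is then \<open>pi\<close> and the sine has constant sign on one period.\<close>

definition chord :: "real \<Rightarrow> real \<Rightarrow> real" where
  "chord lam y = \<bar>2 * sin y\<bar> powr lam"

lemma chord_zero [simp]: "chord lam 0 = 0"
  by (simp add: chord_def)

lemma chord_minus: "chord lam (- y) = chord lam y"
  by (simp add: chord_def)

lemma chord_plus_pi: "chord lam (y + pi) = chord lam y"
  by (simp add: chord_def)

lemma chord_commute: "chord lam (x - y) = chord lam (y - x)"
  using chord_minus[of lam "x - y"] by simp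

lemma dist_cis_powr: "dist (cis (2 * x)) (cis (2 * y)) powr lam = chord lam (x - y)"
proof -
  have "(dist (cis (2 * x)) (cis (2 * y)))\<^sup>2 = (cos (2*x) - cos (2*y))\<^sup>2 + (sin (2*x) - sin (2*y))\<^sup>2"
    by (simp add: dist_norm cmod_power2)
  also have "\<dots> = 2 - 2 * cos (2 * x - 2 * y)"
    using sin_cos_squared_add[of "2*x"] sin_cos_squared_add[of "2*y"]
    by (simp add: cos_diff power2_eq_square algebra_simps)
  also have "\<dots> = (2 * sin (x - y))\<^sup>2"
    using cos_double_sin[of "x - y"] by (simp add: algebra_simps)
  finally have "dist (cis (2 * x)) (cis (2 * y)) = \<bar>2 * sin (x - y)\<bar>"
    by (metis abs_ge_zero power2_abs power2_eq_imp_eq zero_le_dist)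
  then show ?thesis by (simp add: chord_def)
qed

lemma continuous_chord: "lam > 0 \<Longrightarrow> continuous_on A (chord lam)"
  unfolding chord_def by (intro continuous_on_powr' continuous_intros) auto

lemma periodic_int:
  fixes f :: "real \<Rightarrow> 'a"
  assumes "\<And>y. f (y + p) = f y"
  shows "f (y + p * of_int j) = f y"
proof (induction j rule: int_induct[where k = 0])
  case (step1 i)
  then show ?case using assms[of "y + p * of_int i"] by (simp add: algebra_simps)
next
  case (step2 i)
  then show ?case using assms[of "y + p * of_int (i - 1)"] by (simp add: algebra_simps)
qed simp

lemma powr_le_tangent:
  fixes x :: real
  assumes "0 \<le> lam" "lam \<le> 1" "0 \<le> x"
  shows "x powr lam \<le> lam * x + (1 - lam)"
proof (cases "x = 0")
  case False
  then show ?thesis using Youngs_inequality_0[of lam "1 - lam" x 1] assms by simp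
qed (use assms in auto)

lemma powr_midpoint_concave:
  fixes p q :: real
  assumes "0 \<le> lam" "lam \<le> 1" "0 \<le> p" "0 \<le> q"
  shows "p powr lam + q powr lam \<le> 2 * ((p + q) / 2) powr lam"
proof (cases "p + q = 0")
  case False
  define M where "M = (p + q) / 2"
  have M: "M > 0" using False assms by (auto simp: M_def)
  have "(p / M) powr lam + (q / M) powr lam \<le> (lam * (p / M) + (1 - lam)) + (lam * (q / M) + (1 - lam))"
    using assms M by (intro add_mono powr_le_tangent) auto
  also have "\<dots> = lam * ((p + q) / M) + 2 * (1 - lam)" by (simp add: add_divide_distrib algebra_simps)
  also have "(p + q) / M = 2" using M by (simp add: M_def nonzero_divide_eq_eq)
  finally have "((p / M) powr lam + (q / M) powr lam) * M powr lam \<le> 2 * M powr lam"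
    by (intro mult_right_mono) auto
  moreover have "(p / M) powr lam * M powr lam = p powr lam" "(q / M) powr lam * M powr lam = q powr lam"
    using M by (simp_all add: powr_divide)
  ultimately show ?thesis by (simp add: distrib_right M_def)
next
  case True
  then have "p = 0" "q = 0" using assms by linarith+
  then show ?thesis by simp
qed

text \<open>Since \<open>sin (c + d) + sin (c - d) = 2 * sin c * cos d\<close>, the mean of the two sines is at most \<open>sin c\<close>, and the
  concave increasing function \<open>x powr lam\<close> preserves this.\<close>

lemma chord_midpoint:
  assumes "0 < lam" "lam < 1" and d: "\<bar>d\<bar> \<le> c" "\<bar>d\<bar> \<le> pi - c" and c: "0 < c" "c < pi"
  shows "chord lam (c + d) + chord lam (c - d) \<le> 2 * chord lam c"
    and "d \<noteq> 0 \<Longrightarrow> chord lam (c + d) + chord lam (c - d) < 2 * chord lam c"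
proof -
  have sc: "sin c > 0" using c by (rule sin_gt_zero)
  have nn: "sin (c + d) \<ge> 0" "sin (c - d) \<ge> 0" using d by (auto intro!: sin_ge_zero)
  have "\<bar>d\<bar> \<le> pi / 2" using d by linarith
  then have cd: "cos d \<ge> 0" using cos_ge_zero[of d] by (simp add: abs_le_iff)
  have "chord lam (c + d) + chord lam (c - d) = (2 * sin (c + d)) powr lam + (2 * sin (c - d)) powr lam"
    using nn by (simp add: chord_def)
  also have "\<dots> \<le> 2 * ((2 * sin (c + d) + 2 * sin (c - d)) / 2) powr lam"
    using assms nn by (intro powr_midpoint_concave) auto
  also have "(2 * sin (c + d) + 2 * sin (c - d)) / 2 = 2 * sin c * cos d"
    by (simp add: sin_add sin_diff)
  finally have 1: "chord lam (c + d) + chord lam (c - d) \<le> 2 * (2 * sin c * cos d) powr lam" .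
  have 2: "chord lam c = (2 * sin c) powr lam" using sc by (simp add: chord_def)
  have "(2 * sin c * cos d) powr lam \<le> (2 * sin c) powr lam"
    using sc cd assms by (intro powr_mono2) (auto simp: mult_le_cancel_left1)
  with 1 2 show "chord lam (c + d) + chord lam (c - d) \<le> 2 * chord lam c" by linarith
  assume "d \<noteq> 0"
  have "cos d < 1"
  proof -
    have "cos \<bar>d\<bar> < cos 0"
      using \<open>d \<noteq> 0\<close> \<open>\<bar>d\<bar> \<le> pi / 2\<close> pi_gt_zero by (intro cos_monotone_0_pi) auto
    then show ?thesis by simp
  qed
  then have "(2 * sin c * cos d) powr lam < (2 * sin c) powr lam"
    using sc cd assms by (intro powr_less_mono2) (auto simp: mult_less_cancel_left1)
  with 1 2 show "chord lam (c + d) + chord lam (c - d) < 2 * chord lam c" by linarith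
qed

text \<open>The potential at \<open>y\<close> of the \<open>m\<close> equally spaced points \<open>- pi * k / m\<close>.\<close>

definition comb :: "real \<Rightarrow> nat \<Rightarrow> real \<Rightarrow> real" where
  "comb lam m y = (\<Sum>k<m. chord lam (y + pi * real k / real m))"

lemma comb_periodic:
  assumes "m > 0"
  shows "comb lam m (y + pi / real m) = comb lam m y"
proof -
  let ?g = "\<lambda>k. chord lam (y + pi * real k / real m)"
  have "comb lam m (y + pi / real m) = (\<Sum>k<m. ?g (Suc k))"
    unfolding comb_def by (intro sum.cong refl arg_cong[where f = "chord lam"]) (simp add: field_simps)
  moreover have "?g m = ?g 0" using assms chord_plus_pi[of lam y] by simp
  ultimately show ?thesis
    using sum.lessThan_Suc_shift[of ?g m] sum.lessThan_Suc[of ?g m] by (simp add: comb_def)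
qed

lemma comb_periodic_int:
  assumes "m > 0"
  shows "comb lam m (y + pi / real m * of_int j) = comb lam m y"
  using comb_periodic[OF assms] by (rule periodic_int)

lemma comb_reflect:
  assumes "m > 0"
  shows "comb lam m (pi / real m - y) = comb lam m y"
proof -
  let ?g = "\<lambda>k. chord lam (y + pi * real k / real m)"
  have "comb lam m (pi / real m - y) = (\<Sum>k<m. ?g (m - Suc k))"
    unfolding comb_def
  proof (intro sum.cong refl)
    fix k assume "k \<in> {..<m}"
    then have "pi / real m - y + pi * real k / real m = - (y + pi * real (m - Suc k) / real m) + pi"
      using assms by (simp add: of_nat_diff field_simps)
    then show "chord lam (pi / real m - y + pi * real k / real m) = ?g (m - Suc k)"
      by (simp only: chord_plus_pi chord_minus)
  qed
  also have "\<dots> = (\<Sum>k<m. ?g k)" by (rule sum.nat_diff_reindex)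
  finally show ?thesis by (simp add: comb_def)
qed

lemma comb_double:
  assumes "m > 0"
  shows "comb lam (2 * m) y = comb lam m y + comb lam m (y + pi / real (2 * m))"
proof -
  have "(\<Sum>k<2*n. f k) = (\<Sum>k<n. f (2*k)) + (\<Sum>k<n. f (2*k+1))" for f :: "nat \<Rightarrow> real" and n
    by (induction n) auto
  then have "comb lam (2 * m) y = (\<Sum>k<m. chord lam (y + pi * real (2*k) / real (2*m)))
      + (\<Sum>k<m. chord lam (y + pi * real (2*k+1) / real (2*m)))"
    by (simp only: comb_def)
  moreover have "pi * real (2*k) / real (2*m) = pi * real k / real m" for k
    by simp
  moreover have "y + pi * real (2*k+1) / real (2*m) = y + pi / real (2*m) + pi * real k / real m" for k
    using assms by (simp add: field_simps)
  ultimately show ?thesis by (simp only: comb_def)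
qed

text \<open>The potential is symmetric about the midpoint of a gap, so it equals its average over a point and the mirror
  image of that point; averaging in pairs is where concavity enters.\<close>

lemma comb_max_fundamental:
  assumes "m > 0" "0 < lam" "lam < 1" and d: "\<bar>d\<bar> \<le> pi / real (2 * m)"
  shows "comb lam m (pi / real (2 * m) + d) \<le> comb lam m (pi / real (2 * m))"
    and "d \<noteq> 0 \<Longrightarrow> comb lam m (pi / real (2 * m) + d) < comb lam m (pi / real (2 * m))"
proof -
  define c where "c k = pi / real (2 * m) + pi * real k / real m" for k
  have c: "\<bar>d\<bar> \<le> c k" "\<bar>d\<bar> \<le> pi - c k" "0 < c k" "c k < pi" if "k < m" for k
  proof -
    have "c k \<ge> pi / real (2 * m)" using assms(1) by (simp add: c_def)
    moreover have "pi / real (2 * m) > 0" using assms(1) by simp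
    moreover have "real k + 1 \<le> real m" using that by linarith
    then have "pi * (real k + 1) / real m \<le> pi * real m / real m"
      by (intro divide_right_mono mult_left_mono) auto
    then have "c k + pi / real (2 * m) \<le> pi" using assms(1) by (simp add: c_def field_simps)
    ultimately show "\<bar>d\<bar> \<le> c k" "\<bar>d\<bar> \<le> pi - c k" "0 < c k" "c k < pi" using d by linarith+
  qed
  have "pi / real m - (pi / real (2 * m) + d) = pi / real (2 * m) - d"
    by (simp add: field_simps)
  then have "2 * comb lam m (pi / real (2 * m) + d)
      = comb lam m (pi / real (2 * m) + d) + comb lam m (pi / real (2 * m) - d)"
    using comb_reflect[OF assms(1), of lam "pi / real (2 * m) + d"] by simp
  also have "\<dots> = (\<Sum>k<m. chord lam (c k + d) + chord lam (c k - d))"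
    by (simp add: comb_def sum.distrib c_def algebra_simps)
  finally have eq: "2 * comb lam m (pi / real (2 * m) + d) = (\<Sum>k<m. chord lam (c k + d) + chord lam (c k - d))" .
  have eq2: "2 * comb lam m (pi / real (2 * m)) = (\<Sum>k<m. 2 * chord lam (c k))"
    by (simp add: comb_def c_def sum_distrib_left)
  have "(\<Sum>k<m. chord lam (c k + d) + chord lam (c k - d)) \<le> (\<Sum>k<m. 2 * chord lam (c k))"
    using assms c by (intro sum_mono chord_midpoint(1)) auto
  with eq eq2 show "comb lam m (pi / real (2 * m) + d) \<le> comb lam m (pi / real (2 * m))" by linarith
  assume "d \<noteq> 0"
  then have "(\<Sum>k<m. chord lam (c k + d) + chord lam (c k - d)) < (\<Sum>k<m. 2 * chord lam (c k))"
    using assms c by (intro sum_strict_mono chord_midpoint(2)) auto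
  with eq eq2 show "comb lam m (pi / real (2 * m) + d) < comb lam m (pi / real (2 * m))" by linarith
qed

lemma comb_max:
  assumes "m > 0" "0 < lam" "lam < 1"
  shows "comb lam m y \<le> comb lam m (pi / real (2 * m))"
    and "comb lam m y = comb lam m (pi / real (2 * m))
      \<Longrightarrow> \<exists>j::int. y = pi / real (2 * m) + pi / real m * of_int j"
proof -
  define j where "j = \<lfloor>y * real m / pi\<rfloor>"
  define d where "d = y - pi / real m * of_int j - pi / real (2 * m)"
  have y: "y = (pi / real (2 * m) + d) + pi / real m * of_int j" by (simp add: d_def)
  have "of_int j \<le> y * real m / pi" "y * real m / pi \<le> of_int j + 1"
    unfolding j_def by linarith+
  then have "pi / real m * of_int j \<le> y" "y \<le> pi / real m * of_int j + pi / real m"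
    using assms(1) by (simp_all add: field_simps)
  moreover have "pi / real m = 2 * (pi / real (2 * m))" by simp
  ultimately have "\<bar>d\<bar> \<le> pi / real (2 * m)"
    unfolding d_def by linarith
  note * = comb_max_fundamental[OF assms this]
  have eq: "comb lam m y = comb lam m (pi / real (2 * m) + d)"
    unfolding y by (rule comb_periodic_int[OF assms(1)])
  show "comb lam m y \<le> comb lam m (pi / real (2 * m))"
    unfolding eq by (rule *(1))
  assume "comb lam m y = comb lam m (pi / real (2 * m))"
  then have "d = 0" using *(2) eq by fastforce
  then show "\<exists>j::int. y = pi / real (2 * m) + pi / real m * of_int j"
    using y by auto
qed

lemma sum_lessThan_add: "(\<Sum>i<m + n. f i) = (\<Sum>i<m. f i) + (\<Sum>i<n. f (m + i :: nat))"
  for f :: "nat \<Rightarrow> real"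
  by (induction n) (simp_all add: add.assoc)

text \<open>Only the first \<open>K\<close> points are constrained, since the structure theorem is applied to finite
  blocks and to prolongations of them by one point.\<close>

definition greedy_upto :: "real \<Rightarrow> (nat \<Rightarrow> real) \<Rightarrow> nat \<Rightarrow> bool" where
  "greedy_upto lam y K \<longleftrightarrow> (\<forall>n<K. n \<ge> 1 \<longrightarrow>
     (\<forall>z. (\<Sum>k<n. chord lam (z - y k)) \<le> (\<Sum>k<n. chord lam (y n - y k))))"

lemma greedy_upto_mono: "greedy_upto lam y K \<Longrightarrow> L \<le> K \<Longrightarrow> greedy_upto lam y L"
  by (auto simp: greedy_upto_def)

lemma greedy_upto_Suc:
  assumes "greedy_upto lam y L" and "\<And>z. (\<Sum>k<L. chord lam (z - y k)) \<le> (\<Sum>k<L. chord lam (y L - y k))"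
  shows "greedy_upto lam y (Suc L)"
  using assms unfolding greedy_upto_def less_Suc_eq by blast

lemma potential_attains_max:
  assumes "lam > 0"
  shows "\<exists>z0. \<forall>z. (\<Sum>k<L. chord lam (z - x k)) \<le> (\<Sum>k<L. chord lam (z0 - x k))"
proof -
  define U where "U z = (\<Sum>k<L. chord lam (z - x k))" for z
  have "continuous_on {0..pi} U"
    unfolding U_def
    by (intro continuous_on_sum continuous_on_compose2[OF continuous_chord[OF assms, of UNIV]] continuous_intros) auto
  then obtain z0 where z0: "\<And>z. z \<in> {0..pi} \<Longrightarrow> U z \<le> U z0"
    using continuous_attains_sup[of "{0..pi}" U] pi_ge_zero
    by (metis atLeastAtMost_iff compact_Icc empty_iff order_refl)
  have per: "U (z + pi) = U z" for z
    unfolding U_def using chord_plus_pi[of lam] by (intro sum.cong refl) (metis add_diff_eq diff_add_eq)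
  have "U z \<le> U z0" for z
  proof -
    define j where "j = \<lfloor>z / pi\<rfloor>"
    have "of_int j \<le> z / pi" "z / pi \<le> of_int j + 1" unfolding j_def by linarith+
    then have "z - pi * of_int j \<in> {0..pi}" by (simp add: field_simps)
    from z0[OF this] show ?thesis
      using periodic_int[of U pi, OF per, of "z - pi * of_int j" j] by simp
  qed
  then show ?thesis unfolding U_def by blast
qed

text \<open>The points lie in the coset \<open>y 0 + (pi / m) * \<int>\<close>, and \<open>m\<close> of them fill it modulo \<open>pi\<close>. The latter is expressed
  through the potential, which avoids speaking about the order in which the points are visited.\<close>

definition dyadic_structure :: "real \<Rightarrow> (nat \<Rightarrow> real) \<Rightarrow> nat \<Rightarrow> nat \<Rightarrow> bool" where
  "dyadic_structure lam y K m \<longleftrightarrow>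
     (\<forall>i<K. \<exists>j::int. y i = y 0 + pi / real m * of_int j) \<and>
     (K = m \<longrightarrow> (\<forall>z. (\<Sum>i<m. chord lam (z - y i)) = comb lam m (z - y 0)))"

text \<open>After \<open>m\<close> equally spaced points the potential is that of the comb plus that of the new points. The comb
  is maximal exactly at its midpoints. The new points form a greedy sequence of length at most \<open>m\<close>, so prolonging
  it by any maximiser of its own potential keeps it, by the structure known for length up to \<open>m\<close>, inside the coset of
  midpoints. Both summands thus attain their maxima together, and the next point must maximise both.\<close>

lemma greedy_second_block:
  assumes lam: "0 < lam" "lam < 1" and m: "m > 0"
    and IH: "\<And>x L. greedy_upto lam x L \<Longrightarrow> L \<le> m \<Longrightarrow> dyadic_structure lam x L m"
    and g: "greedy_upto lam y (m + J)" and "J \<le> m" and "L \<le> J"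
  shows "greedy_upto lam (\<lambda>i. y (m + i)) L \<and>
    (\<forall>i<L. \<exists>j::int. y (m + i) = y 0 + pi / real (2 * m) + pi / real m * of_int j)"
  using \<open>L \<le> J\<close>
proof (induction L)
  case 0
  then show ?case by (simp add: greedy_upto_def)
next
  case (Suc L)
  define x where "x i = y (m + i)" for i
  define U where "U z = (\<Sum>k<L. chord lam (z - x k))" for z
  from Suc have gx: "greedy_upto lam x L"
    and cx: "\<And>i. i < L \<Longrightarrow> \<exists>j::int. x i = y 0 + pi / real (2 * m) + pi / real m * of_int j"
    by (auto simp: x_def[abs_def])
  have "dyadic_structure lam y m m"
    using g by (intro IH greedy_upto_mono[OF g]) auto
  then have first: "(\<Sum>i<m. chord lam (z - y i)) = comb lam m (z - y 0)" for z
    by (simp add: dyadic_structure_def)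
  have total: "(\<Sum>k<m + L. chord lam (z - y k)) = comb lam m (z - y 0) + U z" for z
    unfolding U_def x_def first[symmetric] by (rule sum_lessThan_add)
  obtain zs where zs: "\<And>z. U z \<le> U zs" and czs: "\<exists>j::int. zs = y 0 + pi / real (2 * m) + pi / real m * of_int j"
  proof (cases "L = 0")
    case True
    show ?thesis by (rule that[of "y 0 + pi / real (2 * m)"]) (auto simp: U_def True intro: exI[of _ 0])
  next
    case False
    obtain z0 where z0: "\<And>z. U z \<le> U z0"
      unfolding U_def using potential_attains_max[OF lam(1)] by blast
    \<comment> \<open>Prolong the new points by a maximiser of their own potential; the result is still greedy.\<close>
    let ?x = "x(L := z0)"
    have U': "(\<Sum>k<L. chord lam (z - ?x k)) = U z" for z
      unfolding U_def by (intro sum.cong) auto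
    have "greedy_upto lam ?x L"
      using gx unfolding greedy_upto_def by (auto intro!: sum.cong)
    then have "greedy_upto lam ?x (Suc L)"
      by (rule greedy_upto_Suc) (simp only: U' fun_upd_same z0)
    then have "dyadic_structure lam ?x (Suc L) m"
      using Suc.prems \<open>J \<le> m\<close> by (intro IH) auto
    then obtain j :: int where "z0 = x 0 + pi / real m * of_int j"
      unfolding dyadic_structure_def using False by (metis fun_upd_other fun_upd_same lessI)
    moreover obtain i :: int where "x 0 = y 0 + pi / real (2 * m) + pi / real m * of_int i"
      using cx[of 0] False by auto
    ultimately have "z0 = y 0 + pi / real (2 * m) + pi / real m * of_int (i + j)"
      by (simp add: algebra_simps)
    with z0 show ?thesis using that by blast
  qed
  \<comment> \<open>At \<open>zs\<close> both potentials are maximal. The greedy point does at least as well in total, hence equally well in each.\<close>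
  have "comb lam m (zs - y 0) = comb lam m (pi / real (2 * m))"
    using czs comb_periodic_int[OF m] by auto
  moreover have "comb lam m (zs - y 0) + U zs \<le> comb lam m (x L - y 0) + U (x L)"
    using g Suc.prems m unfolding greedy_upto_def total[symmetric] x_def by simp
  moreover have "comb lam m (x L - y 0) \<le> comb lam m (pi / real (2 * m))"
    by (rule comb_max(1)[OF m lam])
  ultimately have eqs: "comb lam m (x L - y 0) = comb lam m (pi / real (2 * m))" "U (x L) = U zs"
    using zs[of "x L"] by linarith+
  have "greedy_upto lam x (Suc L)"
    using gx by (rule greedy_upto_Suc) (use zs eqs in \<open>simp add: U_def\<close>)
  moreover have "\<exists>j::int. x L = y 0 + pi / real (2 * m) + pi / real m * of_int j"
    using comb_max(2)[OF m lam eqs(1)] by (auto simp: algebra_simps)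
  ultimately show ?case
    using cx by (auto simp: x_def[abs_def] less_Suc_eq)
qed

theorem greedy_dyadic_structure:
  assumes lam: "0 < lam" "lam < 1" and "greedy_upto lam y K" "K \<le> 2 ^ n"
  shows "dyadic_structure lam y K (2 ^ n)"
  using assms(3,4)
proof (induction n arbitrary: y K)
  case 0
  have "\<exists>j::int. y i = y 0 + pi / real (2 ^ 0) * of_int j" if "i < K" for i
  proof -
    have "i = 0" using that 0 by simp
    then show ?thesis by (intro exI[of _ 0]) simp
  qed
  then show ?case
    by (auto simp: dyadic_structure_def comb_def)
next
  case (Suc n)
  let ?m = "2 ^ n :: nat"
  have m: "?m > 0" by simp
  have half: "pi / real ?m * of_int j = pi / real (2 * ?m) * of_int (2 * j)" for j
    by (simp add: field_simps)
  show ?case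
  proof (cases "K \<le> ?m")
    case True
    then have "\<forall>i<K. \<exists>j::int. y i = y 0 + pi / real ?m * of_int j"
      using Suc.IH[OF Suc.prems(1)] by (simp add: dyadic_structure_def)
    then have "\<forall>i<K. \<exists>j::int. y i = y 0 + pi / real (2 * ?m) * of_int j"
      unfolding half by blast
    with True m show ?thesis by (auto simp: dyadic_structure_def)
  next
    case False
    define J where "J = K - ?m"
    have K: "K = ?m + J" and J: "J \<le> ?m" using False Suc.prems(2) by (auto simp: J_def)
    define x where "x i = y (?m + i)" for i
    have gy: "greedy_upto lam y (?m + J)" using Suc.prems(1) K by simp
    have first: "dyadic_structure lam y ?m ?m"
      by (rule Suc.IH[OF greedy_upto_mono[OF gy]]) auto
    have second: "greedy_upto lam x J"
      "\<And>i. i < J \<Longrightarrow> \<exists>j::int. x i = y 0 + pi / real (2 * ?m) + pi / real ?m * of_int j"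
      using greedy_second_block[OF lam m Suc.IH gy J order.refl] unfolding x_def by auto
    have c1: "\<exists>j::int. y i = y 0 + pi / real (2 * ?m) * of_int j" if i: "i < K" for i
    proof (cases "i < ?m")
      case True
      then show ?thesis using first unfolding dyadic_structure_def half by blast
    next
      case False
      then have "i - ?m < J" using i K by simp
      then obtain j :: int where "x (i - ?m) = y 0 + pi / real (2 * ?m) + pi / real ?m * of_int j"
        using second(2) by blast
      then have "y i = y 0 + pi / real (2 * ?m) * of_int (1 + 2 * j)"
        using False by (simp add: x_def field_simps)
      then show ?thesis by blast
    qed
    have c2: "(\<Sum>i<2 * ?m. chord lam (z - y i)) = comb lam (2 * ?m) (z - y 0)" if "K = 2 * ?m" for z
    proof -
      have "J = ?m" using that K by simp
      have "dyadic_structure lam x ?m ?m"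
        using second(1) \<open>J = ?m\<close> by (intro Suc.IH) auto
      then have sum_x: "(\<Sum>i<?m. chord lam (z - x i)) = comb lam ?m (z - x 0)"
        by (simp add: dyadic_structure_def)
      obtain j :: int where "x 0 = y 0 + pi / real (2 * ?m) + pi / real ?m * of_int j"
        using second(2)[of 0] \<open>J = ?m\<close> by auto
      moreover have "pi / real ?m = 2 * (pi / real (2 * ?m))" by simp
      ultimately have "z - x 0 = (z - y 0 + pi / real (2 * ?m)) + pi / real ?m * of_int (- j - 1)"
        by (simp only: of_int_diff of_int_minus of_int_1) (simp only: algebra_simps)
      then have "comb lam ?m (z - x 0) = comb lam ?m (z - y 0 + pi / real (2 * ?m))"
        by (simp only: comb_periodic_int[OF m])
      moreover have "(\<Sum>i<?m. chord lam (z - y i)) = comb lam ?m (z - y 0)"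
        using first by (simp add: dyadic_structure_def)
      moreover have "(\<Sum>i<2 * ?m. chord lam (z - y i)) = (\<Sum>i<?m. chord lam (z - y i)) + (\<Sum>i<?m. chord lam (z - x i))"
        unfolding x_def mult_2 by (rule sum_lessThan_add)
      ultimately show ?thesis
        using comb_double[OF m] sum_x by simp
    qed
    show ?thesis
      unfolding dyadic_structure_def power_Suc using c1 c2 by blast
  qed
qed


definition chord_energy :: "real \<Rightarrow> (nat \<Rightarrow> real) \<Rightarrow> nat \<Rightarrow> real" where
  "chord_energy lam y N = (\<Sum>i<N. \<Sum>j<N. chord lam (y i - y j))"

lemma greedy_first_block:
  assumes lam: "0 < lam" "lam < 1" and g: "greedy_upto lam y (2 ^ n)"
  shows "(\<Sum>i<2 ^ n. chord lam (z - y i)) = comb lam (2 ^ n) (z - y 0)"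
    and "chord_energy lam y (2 ^ n) = 2 ^ n * comb lam (2 ^ n) 0"
proof -
  have st: "dyadic_structure lam y (2 ^ n) (2 ^ n)"
    using greedy_dyadic_structure[OF lam g order.refl] .
  then show *: "(\<Sum>i<2 ^ n. chord lam (z - y i)) = comb lam (2 ^ n) (z - y 0)" for z
    by (simp add: dyadic_structure_def)
  have "comb lam (2 ^ n) (y i - y 0) = comb lam (2 ^ n) 0" if i: "i < 2 ^ n" for i
  proof -
    obtain j :: int where "y i = y 0 + pi / real (2 ^ n) * of_int j"
      using st i unfolding dyadic_structure_def by blast
    then have "y i - y 0 = 0 + pi / real (2 ^ n) * of_int j" by simp
    then show ?thesis by (simp only: comb_periodic_int zero_less_power zero_less_numeral)
  qed
  then show "chord_energy lam y (2 ^ n) = 2 ^ n * comb lam (2 ^ n) 0"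
    unfolding chord_energy_def * by simp
qed

lemma chord_energy_split:
  "chord_energy lam y (m + J) = chord_energy lam y m
     + 2 * (\<Sum>i<J. \<Sum>k<m. chord lam (y (m + i) - y k)) + chord_energy lam (\<lambda>i. y (m + i)) J"
proof -
  have "(\<Sum>i<m. \<Sum>k<J. chord lam (y i - y (m + k))) = (\<Sum>i<J. \<Sum>k<m. chord lam (y (m + i) - y k))"
    by (subst sum.swap) (intro sum.cong refl chord_commute)
  then show ?thesis
    by (simp add: chord_energy_def sum_lessThan_add sum.distrib)
qed

text \<open>Every point of the second block sits at a midpoint of the first, so each contributes the same cross energy.\<close>

lemma greedy_energy_split:
  assumes lam: "0 < lam" "lam < 1" and g: "greedy_upto lam y (2 ^ n + J)" and J: "J \<le> 2 ^ n"
  shows "chord_energy lam y (2 ^ n + J) = 2 ^ n * comb lam (2 ^ n) 0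
       + 2 * real J * (comb lam (2 * 2 ^ n) 0 - comb lam (2 ^ n) 0)
       + chord_energy lam (\<lambda>i. y (2 ^ n + i)) J"
    and "greedy_upto lam (\<lambda>i. y (2 ^ n + i)) J"
proof -
  let ?m = "2 ^ n :: nat"
  have m: "?m > 0" by simp
  have first: "greedy_upto lam y ?m" by (rule greedy_upto_mono[OF g]) simp
  have second: "greedy_upto lam (\<lambda>i. y (?m + i)) J \<and>
    (\<forall>i<J. \<exists>j::int. y (?m + i) = y 0 + pi / real (2 * ?m) + pi / real ?m * of_int j)"
    by (rule greedy_second_block[OF lam m greedy_dyadic_structure[OF lam] g J order.refl])
  then show "greedy_upto lam (\<lambda>i. y (2 ^ n + i)) J" by simp
  have "(\<Sum>k<?m. chord lam (y (?m + i) - y k)) = comb lam (2 * ?m) 0 - comb lam ?m 0" if i: "i < J" for i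
  proof -
    obtain j :: int where "y (?m + i) = y 0 + pi / real (2 * ?m) + pi / real ?m * of_int j"
      using second i by blast
    then have "y (?m + i) - y 0 = pi / real (2 * ?m) + pi / real ?m * of_int j" by simp
    then have "(\<Sum>k<?m. chord lam (y (?m + i) - y k)) = comb lam ?m (pi / real (2 * ?m))"
      by (simp only: greedy_first_block(1)[OF lam first] comb_periodic_int[OF m])
    then show ?thesis using comb_double[OF m, of lam 0] by simp
  qed
  then show "chord_energy lam y (2 ^ n + J) = 2 ^ n * comb lam (2 ^ n) 0
       + 2 * real J * (comb lam (2 * 2 ^ n) 0 - comb lam (2 ^ n) 0)
       + chord_energy lam (\<lambda>i. y (2 ^ n + i)) J"
    unfolding chord_energy_split greedy_first_block(2)[OF lam first] by simp
qed

text \<open>Binary expansions are strictly decreasing lists of exponents; decreasing order matches the greedy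
  construction, in which the largest block comes first.\<close>

primrec binary_value :: "nat list \<Rightarrow> nat" where
  "binary_value [] = 0"
| "binary_value (e # es) = 2 ^ e + binary_value es"

lemma binary_value_less: "sorted_wrt (>) es \<Longrightarrow> (\<And>e. e \<in> set es \<Longrightarrow> e < n) \<Longrightarrow> binary_value es < 2 ^ n"
proof (induction es arbitrary: n)
  case (Cons e es)
  have "binary_value es < 2 ^ e" using Cons by auto
  moreover have "2 * 2 ^ e \<le> (2 ^ n :: nat)"
    using Cons.prems(2)[of e] power_increasing[of "Suc e" n "2::nat"] by simp
  ultimately show ?case by simp
qed simp

lemma binary_value_surj: "\<exists>es. sorted_wrt (>) es \<and> binary_value es = N \<and> (\<forall>e\<in>set es. 2 ^ e \<le> N)"
proof (induction N rule: less_induct)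
  case (less N)
  show ?case
  proof (cases "N = 0")
    case False
    then obtain n where n: "2 ^ n \<le> N" "N < 2 ^ Suc n"
      using ex_power_ivl1[of 2 N] by auto
    have "N - 2 ^ n < N" using False by simp
    from less[OF this] obtain es where es: "sorted_wrt (>) es" "binary_value es = N - 2 ^ n"
      "\<And>e. e \<in> set es \<Longrightarrow> 2 ^ e \<le> N - 2 ^ n" by blast
    have "e < n" if "e \<in> set es" for e
    proof -
      have "(2::nat) ^ e < 2 ^ n" using es(3)[OF that] n unfolding power_Suc by linarith
      then show ?thesis by (simp only: power_strict_increasing_iff one_less_numeral_iff semiring_norm)
    qed
    moreover have "2 ^ e \<le> N" if "e \<in> set es" for e using es(3)[OF that] by simp
    ultimately show ?thesis using es n by (intro exI[of _ "n # es"]) auto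
  qed (auto intro: exI[of _ "[]"])
qed

text \<open>The energy of the first \<open>binary_value es\<close> greedy points: for each block its own energy and its
  interaction with all later, smaller blocks.\<close>

primrec block_energy :: "real \<Rightarrow> nat list \<Rightarrow> real" where
  "block_energy lam [] = 0"
| "block_energy lam (e # es) = 2 ^ e * comb lam (2 ^ e) 0
     + 2 * real (binary_value es) * (comb lam (2 * 2 ^ e) 0 - comb lam (2 ^ e) 0) + block_energy lam es"

theorem greedy_energy_binary:
  assumes lam: "0 < lam" "lam < 1"
  shows "sorted_wrt (>) es \<Longrightarrow> greedy_upto lam y (binary_value es)
    \<Longrightarrow> chord_energy lam y (binary_value es) = block_energy lam es"
proof (induction es arbitrary: y)
  case Nil
  then show ?case by (simp add: chord_energy_def)
next
  case (Cons e es)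
  have "binary_value es \<le> 2 ^ e"
    using Cons.prems(1) binary_value_less[of es e] by auto
  note split = greedy_energy_split[OF lam _ this, of y]
  show ?case
    using Cons split by simp
qed

section \<open>The energy of the uniform measure\<close>

text \<open>Rotation invariance of the uniform measure, in the form needed for the kernel.\<close>

lemma integral_chord_shift:
  assumes lam: "lam > 0"
  shows "integral {c - pi..c} (chord lam) = integral {0..pi} (chord lam)"
proof -
  define A where "A = \<bar>c\<bar> + 2 * pi"
  have A: "c - pi \<ge> - A" "c \<le> A - pi" "-A \<le> - pi" "pi \<le> A" using pi_gt_zero unfolding A_def by linarith+
  obtain Q where Q: "\<And>x. x \<in> {-A..A} \<Longrightarrow> (Q has_vector_derivative chord lam x) (at x within {-A..A})"
    using antiderivative_continuous[OF continuous_chord[OF lam]] by blast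
  have int: "integral {a..a + pi} (chord lam) = Q (a + pi) - Q a" if "-A \<le> a" "a + pi \<le> A" for a
  proof (intro integral_unique fundamental_theorem_of_calculus)
    fix x assume "x \<in> {a..a + pi}"
    then show "(Q has_vector_derivative chord lam x) (at x within {a..a + pi})"
      using that by (intro has_vector_derivative_within_subset[OF Q]) auto
  qed simp
  \<comment> \<open>By periodicity this difference of antiderivatives has derivative zero.\<close>
  have "\<exists>k. \<forall>x\<in>{-A..A - pi}. Q (x + pi) - Q x = k"
  proof (rule has_field_derivative_zero_constant)
    fix x assume x: "x \<in> {-A..A - pi}"
    have "((\<lambda>y. y + pi) has_vector_derivative 1) (at x within {-A..A - pi})"
      by (auto intro!: derivative_eq_intros)
    moreover have "- A \<le> y + pi" if "- A \<le> y" for y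
      using that pi_gt_zero by linarith
    then have "(Q has_vector_derivative chord lam (x + pi)) (at (x + pi) within (\<lambda>y. y + pi) ` {-A..A - pi})"
      using x by (intro has_vector_derivative_within_subset[OF Q]) auto
    ultimately have "((Q \<circ> (\<lambda>y. y + pi)) has_vector_derivative (1 *\<^sub>R chord lam (x + pi))) (at x within {-A..A - pi})"
      by (rule vector_diff_chain_within)
    moreover have "y \<le> A" if "y \<le> A - pi" for y
      using that pi_gt_zero by linarith
    then have "(Q has_vector_derivative chord lam x) (at x within {-A..A - pi})"
      using x by (intro has_vector_derivative_within_subset[OF Q]) auto
    ultimately have "((\<lambda>x. Q (x + pi) - Q x) has_vector_derivative (chord lam (x + pi) - chord lam x)) (at x within {-A..A - pi})"
      using has_vector_derivative_diff by (fastforce simp: o_def)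
    then show "((\<lambda>x. Q (x + pi) - Q x) has_field_derivative 0) (at x within {-A..A - pi})"
      by (simp add: chord_plus_pi has_real_derivative_iff_has_vector_derivative)
  qed simp
  then obtain k where k: "\<And>x. x \<in> {-A..A - pi} \<Longrightarrow> Q (x + pi) - Q x = k" by blast
  have "integral {c - pi..c - pi + pi} (chord lam) = k" "integral {0..0 + pi} (chord lam) = k"
    using A k[of "c - pi"] k[of 0] pi_gt_zero by (simp_all only: int atLeastAtMost_iff) auto
  then show ?thesis by simp
qed

lemma integral_sigma1:
  fixes g :: "complex \<Rightarrow> real"
  assumes g: "continuous_on UNIV g"
  shows "(LINT x|sigma1. g x) = integral {0..2 * pi} (\<lambda>t. g (cis t)) / (2 * pi)"
proof -
  have gm [measurable]: "g \<in> borel_measurable borel"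
    using g by (rule borel_measurable_continuous_onI)
  have cis [measurable]: "cis \<in> borel_measurable borel"
    by (intro borel_measurable_continuous_onI continuous_intros)
  have cis': "cis \<in> measurable (uniform_measure lborel {0..2 * pi}) borel"
    by (subst measurable_cong_sets[of _ borel _ borel]) (auto simp: uniform_measure_def)
  have "(LINT x|sigma1. g x) = (LINT t|uniform_measure lborel {0..2 * pi}. g (cis t))"
    unfolding sigma1_def by (rule integral_distr[OF cis' gm])
  also have "uniform_measure lborel {0..2 * pi} = density lborel (\<lambda>t. ennreal (indicator {0..2 * pi} t / (2 * pi)))"
    unfolding uniform_measure_def
    by (intro density_cong) (auto simp: divide_ennreal indicator_def simp flip: ennreal_1)
  also have "(LINT t|\<dots>. g (cis t)) = (LINT t|lborel. indicator {0..2 * pi} t / (2 * pi) * g (cis t))"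
    by (subst integral_density) (auto simp: indicator_def)
  also have "\<dots> = (LINT t|lborel. (indicator {0..2 * pi} t * g (cis t)) / (2 * pi))"
    by (intro Bochner_Integration.integral_cong refl) simp
  also have "\<dots> = (LINT t:{0..2 * pi}|lborel. g (cis t)) / (2 * pi)"
    by (simp add: set_lebesgue_integral_def)
  also have "(LINT t:{0..2 * pi}|lborel. g (cis t)) = integral {0..2 * pi} (\<lambda>t. g (cis t))"
  proof (rule set_borel_integral_eq_integral)
    show "set_integrable lborel {0..2 * pi} (\<lambda>t. g (cis t))"
      unfolding set_integrable_def
      by (intro borel_integrable_compact continuous_on_compose2[OF g] continuous_intros) auto
  qed
  finally show ?thesis .
qed

theorem I_energy_sigma1:
  assumes lam: "lam > 0"
  shows "I_energy lam sigma1 = integral {0..pi} (chord lam) / pi"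
proof -
  let ?J = "integral {0..pi} (chord lam) / pi"
  have inner: "(LINT y|sigma1. dist (cis u) y powr lam) = ?J" for u
  proof -
    have "(LINT y|sigma1. dist (cis u) y powr lam)
        = integral {0..2 * pi} (\<lambda>t. dist (cis u) (cis t) powr lam) / (2 * pi)"
      using lam by (intro integral_sigma1 continuous_on_powr' continuous_intros) auto
    also have "(\<lambda>t. dist (cis u) (cis t) powr lam) = (\<lambda>t. chord lam (t / 2 - u / 2))"
      using dist_cis_powr[of "u / 2" "t / 2" lam for t] by (simp add: chord_commute[of lam "u / 2"])
    also have "integral {0..2 * pi} (\<lambda>t. chord lam (t / 2 - u / 2)) = 2 * integral {-(u / 2)..pi - u / 2} (chord lam)"
    proof (rule integral_unique)
      have "(chord lam has_integral integral {-(u/2)..pi - u/2} (chord lam)) (cbox (-(u/2)) (pi - u/2))"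
        unfolding cbox_interval
        using lam by (intro integrable_integral integrable_continuous_real continuous_chord)
      moreover have "(\<lambda>x. u + x * 2) ` {-(u / 2)..pi - u / 2} = {0..pi * 2}"
        using image_affinity_atLeastAtMost[of 2 u "-(u / 2)" "pi - u / 2"]
        by (simp add: mult.commute add.commute)
      ultimately
      show "((\<lambda>t. chord lam (t / 2 - u / 2)) has_integral 2 * integral {-(u / 2)..pi - u / 2} (chord lam)) {0..2 * pi}"
        using has_integral_affinity[of "chord lam" "integral {-(u/2)..pi - u/2} (chord lam)"
            "-(u/2)" "pi - u/2" "1/2" "- u/2"]
        by (simp add: algebra_simps)
    qed
    also have "integral {-(u / 2)..pi - u / 2} (chord lam) = integral {0..pi} (chord lam)"
      using integral_chord_shift[OF lam, of "pi - u / 2"] by simp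
    finally show ?thesis by simp
  qed
  define f where "f x = (LINT y|sigma1. dist x y powr lam)" for x
  have sets: "sets sigma1 = sets borel" by (simp add: sigma1_def)
  have fin: "finite_measure (uniform_measure lborel {0..2 * pi})"
  proof
    have "emeasure (uniform_measure lborel {0..2 * pi}) UNIV = ennreal (2 * pi) / ennreal (2 * pi)"
      by (subst emeasure_uniform_measure) auto
    also have "\<dots> = ennreal (2 * pi / (2 * pi))" by (rule divide_ennreal) auto
    finally show "emeasure (uniform_measure lborel {0..2 * pi}) (space (uniform_measure lborel {0..2 * pi})) \<noteq> \<infinity>"
      by simp
  qed
  have cis': "cis \<in> measurable (uniform_measure lborel {0..2 * pi}) borel"
    by (subst measurable_cong_sets[of _ borel _ borel])
       (auto simp: uniform_measure_def intro!: borel_measurable_continuous_onI continuous_intros)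
  interpret sigma1: finite_measure sigma1
    unfolding sigma1_def by (rule finite_measure.finite_measure_distr[OF fin cis'])
  have "(\<lambda>(x, y). dist x y powr lam) \<in> borel_measurable (borel \<Otimes>\<^sub>M borel :: (complex \<times> complex) measure)"
    unfolding borel_prod split_def using lam
    by (intro borel_measurable_continuous_onI continuous_on_powr' continuous_intros) auto
  then have "(\<lambda>(x, y). dist x y powr lam) \<in> borel_measurable (borel \<Otimes>\<^sub>M sigma1)"
    by (simp add: measurable_cong_sets[OF sets_pair_measure_cong[OF refl sets] refl])
  then have "f \<in> borel_measurable borel"
    unfolding f_def by (rule sigma1.borel_measurable_lebesgue_integral)
  then have "(LINT x|sigma1. f x) = (LINT t|uniform_measure lborel {0..2 * pi}. f (cis t))"
    unfolding sigma1_def by (rule integral_distr[OF cis'])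
  also have "\<dots> = (LINT x|sigma1. ?J)"
    unfolding f_def inner unfolding sigma1_def by (rule integral_distr[OF cis', symmetric]) simp
  also have "\<dots> = ?J"
    using integral_sigma1[of "\<lambda>_. ?J"] by simp
  finally show ?thesis unfolding I_energy_def f_def .
qed

section \<open>Asymptotics of the energy of equally spaced points\<close>

lemma sin_ge_half:
  assumes "0 \<le> x" "x \<le> pi / 2"
  shows "x / 2 \<le> sin x"
proof (cases "x \<le> pi / 3")
  case True
  show ?thesis
  proof (cases "x = 0")
    case False
    then obtain z where z: "0 < z" "z < x" "sin x - sin 0 = (x - 0) * cos z"
      using MVT2[of 0 x sin cos] assms by (auto simp: DERIV_sin)
    have "cos (pi / 3) \<le> cos z" using z True by (intro cos_monotone_0_pi_le) auto
    then have "x * (1 / 2) \<le> x * cos z" using assms by (intro mult_left_mono) (simp_all add: cos_60)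
    then show ?thesis using z by simp
  qed simp
next
  case False
  then have "sin (pi / 3) \<le> sin x" using assms by (intro sin_monotone_2pi_le) auto
  moreover have "17 / 10 \<le> sqrt 3" by (rule real_le_rsqrt) (simp add: power2_eq_square)
  moreover have "x \<le> 17 / 10" using assms pi_less_4 pi_approx by simp
  ultimately show ?thesis by (simp add: sin_60)
qed

definition chord_integral :: "real \<Rightarrow> real \<Rightarrow> real" where
  "chord_integral lam x = integral {0..x} (chord lam)"

lemma chord_integral_derivative:
  assumes "lam > 0" "0 < x" "x < pi"
  shows "(chord_integral lam has_real_derivative chord lam x) (at x)"
proof -
  have "(chord_integral lam has_real_derivative chord lam x) (at x within {0..pi})"
    unfolding chord_integral_def[abs_def] using assms
    by (intro integral_has_real_derivative continuous_chord) auto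
  then show ?thesis using assms by (simp add: at_within_Icc_at)
qed

text \<open>Reflection at \<open>pi / 2\<close>.\<close>

lemma chord_integral_half:
  assumes "lam > 0"
  shows "chord_integral lam pi = 2 * chord_integral lam (pi / 2)"
proof -
  have int: "chord lam integrable_on {a..b}" for a b
    using assms by (intro integrable_continuous_real continuous_chord)
  have "integral {pi / 2..pi} (chord lam) = integral {0..pi / 2} (chord lam)"
  proof (rule integral_unique)
    have "(chord lam has_integral integral {0..pi / 2} (chord lam)) (cbox 0 (pi / 2))"
      unfolding cbox_interval by (rule integrable_integral[OF int])
    from has_integral_affinity[OF this, of "-1" pi]
    have "((\<lambda>x. chord lam (pi - x)) has_integral integral {0..pi / 2} (chord lam)) ((\<lambda>x. pi - x) ` {0..pi / 2})"
      by (simp add: algebra_simps)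
    moreover have "(\<lambda>x. pi - x) ` {0..pi / 2} = {pi / 2..pi}" by simp
    moreover have "chord lam (pi - x) = chord lam x" for x by (simp add: chord_def)
    ultimately show "(chord lam has_integral integral {0..pi / 2} (chord lam)) {pi / 2..pi}" by simp
  qed
  then show ?thesis
    using Henstock_Kurzweil_Integration.integral_combine[of 0 "pi / 2" pi "chord lam"] int
    by (simp add: chord_integral_def)
qed

text \<open>The error of the trapezoidal rule with step \<open>pi / m\<close> on the \<open>k\<close>-th cell, scaled by \<open>m powr lam\<close>. With this
  scaling the cell becomes \<open>[k, k + 1]\<close> and the integrand \<open>m powr lam * chord lam (pi * x / m)\<close>, which tends to
  \<open>(2 * pi * x) powr lam\<close>.\<close>

definition chord_trapezoid_error :: "real \<Rightarrow> nat \<Rightarrow> nat \<Rightarrow> real" where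
  "chord_trapezoid_error lam m k = real m powr lam *
     ((chord lam (pi * real k / real m) + chord lam (pi * real (Suc k) / real m)) / 2
      - real m / pi * (chord_integral lam (pi * real (Suc k) / real m) - chord_integral lam (pi * real k / real m)))"

text \<open>The dominating sequence for the passage to the limit. The restriction to the left half of the period keeps the
  cell away from the second singularity.\<close>

lemma chord_trapezoid_error_bound:
  assumes lam: "0 < lam" "lam < 1" and k: "1 \<le> k" "2 * Suc k \<le> m"
  shows "\<bar>chord_trapezoid_error lam m k\<bar> \<le> 4 * pi\<^sup>2 * pi powr (lam - 2) * real k powr (lam - 2)"
proof -
  have m: "real m > 0" using k by simp
  define c where "c = pi / real m"
  have c: "c > 0" using m by (simp add: c_def)
  let ?f = "\<lambda>x. real m powr lam * (2 * sin (c * x)) powr lam"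
  let ?f' = "\<lambda>x. real m powr lam * (lam * (2 * sin (c * x)) powr (lam - 1) * (2 * cos (c * x) * c))"
  let ?f'' = "\<lambda>x. real m powr lam * (lam * ((lam - 1) * (2 * sin (c * x)) powr (lam - 2) * (2 * cos (c * x) * c)
       * (2 * cos (c * x) * c) - (2 * sin (c * x)) powr (lam - 1) * (2 * sin (c * x) * c * c)))"
  let ?P = "\<lambda>x. real m powr lam / c * chord_integral lam (c * x)"
  define B where "B = 8 * pi\<^sup>2 * pi powr (lam - 2) * real k powr (lam - 2)"
  have range: "0 < c * x" "c * x \<le> pi / 2" if "real k \<le> x" "x \<le> real k + 1" for x
  proof -
    show "0 < c * x" using that k c by (intro mult_pos_pos) auto
    have "2 * real (Suc k) \<le> real m" using k(2) by linarith
    then have "2 * x \<le> real m" using that by simp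
    then show "c * x \<le> pi / 2" using m by (simp add: c_def field_simps)
  qed
  have sin_pos: "0 < sin (c * x)" if "real k \<le> x" "x \<le> real k + 1" for x
    using range[OF that] by (intro sin_gt_zero) (auto intro: le_less_trans)
  have dP: "(?P has_real_derivative ?f x) (at x)" if x: "real k \<le> x" "x \<le> real k + 1" for x
  proof -
    have "c * x < pi" using range[OF x] pi_gt_zero by linarith
    then have "(chord_integral lam has_real_derivative chord lam (c * x)) (at (c * x))"
      using range[OF x] lam by (intro chord_integral_derivative)
    then have "((\<lambda>x. chord_integral lam (c * x)) has_real_derivative chord lam (c * x) * c) (at x)"
      by (rule DERIV_chain2) (auto intro!: derivative_eq_intros)
    then have "(?P has_real_derivative real m powr lam / c * (chord lam (c * x) * c)) (at x)"
      by (rule DERIV_cmult)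
    moreover have "chord lam (c * x) = (2 * sin (c * x)) powr lam"
      using sin_pos[OF x] by (simp add: chord_def)
    ultimately show ?thesis using c by simp
  qed
  have df: "(?f has_real_derivative ?f' x) (at x)" if x: "real k \<le> x" "x \<le> real k + 1" for x
    using sin_pos[OF x] by (auto intro!: derivative_eq_intros)
  have df': "(?f' has_real_derivative ?f'' x) (at x)" if x: "real k \<le> x" "x \<le> real k + 1" for x
    using sin_pos[OF x] by (auto intro!: derivative_eq_intros simp: algebra_simps)
  have bound: "\<bar>?f'' x\<bar> \<le> B" if x: "real k \<le> x" "x \<le> real k + 1" for x
  proof -
    define u where "u = 2 * sin (c * x)"
    have u: "u > 0" using sin_pos[OF x] by (simp add: u_def)
    have u1: "u powr (lam - 1) * u = u powr (lam - 2) * u\<^sup>2"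
      using u powr_add[of u "lam - 2" 1] by (simp add: power2_eq_square)
    have eq: "?f'' x = real m powr lam * (lam * c\<^sup>2 * u powr (lam - 2) * ((lam - 1) * (2 * cos (c * x))\<^sup>2 - u\<^sup>2))"
    proof -
      have "?f'' x = real m powr lam * (lam * ((lam - 1) * u powr (lam - 2) * (2 * cos (c * x) * c)
          * (2 * cos (c * x) * c) - (u powr (lam - 1) * u) * c\<^sup>2))"
        by (simp only: u_def power2_eq_square mult.assoc)
      also have "\<dots> = real m powr lam * (lam * c\<^sup>2 * u powr (lam - 2) * ((lam - 1) * (2 * cos (c * x))\<^sup>2 - u\<^sup>2))"
        unfolding u1 by (simp only: power2_eq_square) (simp only: algebra_simps)
      finally show ?thesis .
    qed
    have "\<bar>(lam - 1) * (2 * cos (c * x))\<^sup>2 - u\<^sup>2\<bar> \<le> 8"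
    proof -
      have "(2 * cos (c * x))\<^sup>2 \<le> 4" "u\<^sup>2 \<le> 4"
        by (simp_all add: u_def power_mult_distrib abs_square_le_1)
      moreover have "0 \<le> (1 - lam) * (2 * cos (c * x))\<^sup>2" "(1 - lam) * (2 * cos (c * x))\<^sup>2 \<le> 1 * (2 * cos (c * x))\<^sup>2"
        using lam by (intro mult_nonneg_nonneg mult_right_mono; simp)+
      moreover have "u\<^sup>2 \<ge> 0" by simp
      moreover have "(lam - 1) * (2 * cos (c * x))\<^sup>2 = - ((1 - lam) * (2 * cos (c * x))\<^sup>2)"
        by (simp only: minus_mult_left minus_diff_eq)
      ultimately show ?thesis by linarith
    qed
    moreover have "u powr (lam - 2) \<le> (c * real k) powr (lam - 2)"
    proof (rule powr_mono2')
      have "c * real k \<le> c * x" using c x by simp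
      also have "c * x \<le> u" using sin_ge_half[of "c * x"] range[OF x] by (simp add: u_def)
      finally show "c * real k \<le> u" .
      show "0 < c * real k" using c k by simp
    qed (use lam in auto)
    ultimately have "\<bar>?f'' x\<bar> \<le> real m powr lam * (1 * c\<^sup>2 * (c * real k) powr (lam - 2) * 8)"
      unfolding eq abs_mult using lam by (intro mult_mono) auto
    also have "\<dots> = B"
    proof -
      have "real m powr lam * c\<^sup>2 * (c * real k) powr (lam - 2)
          = real m powr lam * (pi\<^sup>2 / (real m)\<^sup>2) * (pi powr (lam - 2) / real m powr (lam - 2) * real k powr (lam - 2))"
        using m by (simp add: c_def powr_mult powr_divide power_divide)
      moreover have "real m powr lam = real m powr (lam - 2) * (real m)\<^sup>2"
        using m powr_add[of "real m" "lam - 2" 2] by (simp add: powr_numeral)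
      ultimately have "real m powr lam * c\<^sup>2 * (c * real k) powr (lam - 2)
          = pi\<^sup>2 * (pi powr (lam - 2) * real k powr (lam - 2))"
        using m by simp
      then show ?thesis unfolding B_def by simp
    qed
    finally show ?thesis .
  qed
  have B: "B \<ge> 0" by (simp add: B_def)
  have abs: "- B \<le> t \<and> t \<le> B" if "\<bar>t\<bar> \<le> B" for t using that by linarith
  have bound': "- B \<le> ?f'' x \<and> ?f'' x \<le> B" if "real k \<le> x" "x \<le> real k + 1" for x
    by (rule abs[OF bound[OF that]])
  have "- B / 2 \<le> (?f (real k) + ?f (real k + 1)) / 2 - (?P (real k + 1) - ?P (real k))"
       "(?f (real k) + ?f (real k + 1)) / 2 - (?P (real k + 1) - ?P (real k)) \<le> B / 2"
    using trapezoid_error_bounds[of "real k" ?P ?f ?f' ?f'' "- B" B, OF dP df df' bound'] B by simp_all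
  moreover have "chord_trapezoid_error lam m k = (?f (real k) + ?f (real k + 1)) / 2 - (?P (real k + 1) - ?P (real k))"
  proof -
    have "chord lam (c * x) = (2 * sin (c * x)) powr lam" if "real k \<le> x" "x \<le> real k + 1" for x
      using sin_pos[OF that] by (simp add: chord_def)
    from this[of "real k"] this[of "real k + 1"]
    have "chord lam (c * real k) = (2 * sin (c * real k)) powr lam"
      "chord lam (c * (real k + 1)) = (2 * sin (c * (real k + 1))) powr lam" by simp_all
    then show ?thesis
      unfolding chord_trapezoid_error_def
      by (simp add: c_def algebra_simps add_divide_distrib)
  qed
  ultimately show ?thesis by (simp add: B_def abs_le_iff)
qed

lemma chord_asymp: 
  assumes "lam > 0" shows "((\<lambda>x. chord lam x / x powr lam) \<longlongrightarrow> 2 powr lam) (at_right 0)"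
proof -
  have "((\<lambda>x::real. 2 * (sin x / x)) \<longlongrightarrow> 2 * 1) (at_right 0)"
  proof (intro tendsto_intros)
    have "((\<lambda>x::real. (sin x - sin 0) / (x - 0)) \<longlongrightarrow> cos 0) (at 0)"
      using DERIV_sin[of "0::real"] by (simp only: has_field_derivative_iff)
    then show "((\<lambda>x::real. sin x / x) \<longlongrightarrow> 1) (at_right 0)"
      by (simp add: filterlim_at_split)
  qed
  then have "((\<lambda>x. (2 * (sin x / x)) powr lam) \<longlongrightarrow> (2 * 1) powr lam) (at_right 0)"
    by (intro tendsto_powr) auto
  moreover have "\<forall>\<^sub>F x in at_right (0::real). (2 * (sin x / x)) powr lam = chord lam x / x powr lam"
    unfolding eventually_at_right_field
  proof (intro exI[of _ pi] conjI allI impI)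
    fix x :: real assume x: "0 < x" "x < pi"
    then have "sin x > 0" by (intro sin_gt_zero)
    then show "(2 * (sin x / x)) powr lam = chord lam x / x powr lam"
      using x by (simp add: chord_def powr_divide powr_mult)
  qed simp
  ultimately have "((\<lambda>x. chord lam x / x powr lam) \<longlongrightarrow> (2 * 1) powr lam) (at_right 0)"
    by (rule Lim_transform_eventually)
  then show ?thesis by simp
qed

lemma chord_integral_asymp:
  assumes "lam > 0"
  shows "((\<lambda>x. chord_integral lam x / x powr (lam + 1)) \<longlongrightarrow> 2 powr lam / (lam + 1)) (at_right 0)"
proof (rule lhopital_right_0)
  have "continuous_on {0..pi} (chord_integral lam)"
    unfolding chord_integral_def[abs_def] using assms
    by (intro indefinite_integral_continuous_1 integrable_continuous_real continuous_chord)
  then have "(chord_integral lam \<longlongrightarrow> chord_integral lam 0) (at 0 within {0..pi})"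
    by (simp add: continuous_on)
  then have "(chord_integral lam \<longlongrightarrow> 0) (at 0 within {0..pi})"
    by (simp add: chord_integral_def)
  then show "(chord_integral lam \<longlongrightarrow> 0) (at_right 0)"
    by (simp add: at_within_Icc_at_right)
  have "((\<lambda>x. x powr (lam + 1)) \<longlongrightarrow> 0 powr (lam + 1)) (at_right (0::real))"
    using assms by (intro tendsto_powr' tendsto_intros) (auto simp: eventually_at_right_less eventually_at_filter)
  then show "((\<lambda>x. x powr (lam + 1)) \<longlongrightarrow> 0) (at_right (0::real))" by simp
  have pos: "\<forall>\<^sub>F x in at_right (0::real). x > 0" by (rule eventually_at_right_less)
  then show "\<forall>\<^sub>F x in at_right (0::real). x powr (lam + 1) \<noteq> 0" by eventually_elim simp
  from pos show "\<forall>\<^sub>F x in at_right (0::real). (lam + 1) * x powr lam \<noteq> 0"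
    by eventually_elim (use assms in simp)
  from pos show "\<forall>\<^sub>F x in at_right (0::real). ((\<lambda>x. x powr (lam + 1)) has_real_derivative (lam + 1) * x powr lam) (at x)"
    by eventually_elim (auto intro!: derivative_eq_intros)
  show "\<forall>\<^sub>F x in at_right 0. (chord_integral lam has_real_derivative chord lam x) (at x)"
    unfolding eventually_at_right_field using chord_integral_derivative[OF assms] pi_gt_zero by blast
  have "((\<lambda>x. (chord lam x / x powr lam) / (lam + 1)) \<longlongrightarrow> 2 powr lam / (lam + 1)) (at_right 0)"
    using assms by (intro tendsto_divide chord_asymp tendsto_const) auto
  then show "((\<lambda>x. chord lam x / ((lam + 1) * x powr lam)) \<longlongrightarrow> 2 powr lam / (lam + 1)) (at_right 0)"
    by (simp add: mult.commute)
qed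

text \<open>If \<open>g x\<close> behaves like \<open>L * x powr b\<close> at \<open>0\<close>, then rescaling recovers this power.\<close>

lemma scaled_limit:
  assumes lim: "((\<lambda>x. g x / x powr b) \<longlongrightarrow> L) (at_right 0)" and g0: "g 0 = 0" and "b > 0" and y: "y \<ge> 0"
  shows "(\<lambda>m. real m powr b * g (pi * y / real m)) \<longlonglongrightarrow> (pi * y) powr b * L"
proof (cases "y = 0")
  case False
  then have py: "pi * y > 0" using y by simp
  have "filterlim (\<lambda>m. pi * y / real m) (at_right 0) sequentially"
    unfolding filterlim_at
  proof
    show "\<forall>\<^sub>F m in sequentially. pi * y / real m \<in> {0<..} \<and> pi * y / real m \<noteq> 0"
      using eventually_gt_at_top[of 0] by eventually_elim (use py in auto)
    show "(\<lambda>m. pi * y / real m) \<longlonglongrightarrow> 0"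
      by (intro tendsto_divide_0[OF tendsto_const] filterlim_at_top_imp_at_infinity filterlim_real_sequentially)
  qed
  from filterlim_compose[OF lim this]
  have "(\<lambda>m. (pi * y) powr b * (g (pi * y / real m) / (pi * y / real m) powr b)) \<longlonglongrightarrow> (pi * y) powr b * L"
    by (rule tendsto_mult_left)
  moreover have "\<forall>\<^sub>F m in sequentially. (pi * y) powr b * (g (pi * y / real m) / (pi * y / real m) powr b)
      = real m powr b * g (pi * y / real m)"
    using eventually_gt_at_top[of 0]
  proof eventually_elim
    case (elim m)
    have "(pi * y / real m) powr b = (pi * y) powr b / real m powr b"
      using py by (simp add: powr_divide)
    then show ?case using py elim False by simp
  qed
  ultimately show ?thesis by (rule Lim_transform_eventually)
qed (use g0 \<open>b > 0\<close> in simp)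

lemma chord_trapezoid_error_limit:
  assumes "lam > 0"
  shows "(\<lambda>m. chord_trapezoid_error lam m k) \<longlonglongrightarrow> (2 * pi) powr lam * powr_trapezoid_error lam k"
proof -
  have f: "(\<lambda>m. real m powr lam * chord lam (pi * y / real m)) \<longlonglongrightarrow> (2 * pi) powr lam * y powr lam" if "y \<ge> 0" for y
    using scaled_limit[OF chord_asymp[OF assms] _ assms that] by (simp add: powr_mult mult_ac)
  have P: "(\<lambda>m. real m powr (lam + 1) * chord_integral lam (pi * y / real m) / pi)
      \<longlonglongrightarrow> (2 * pi) powr lam * (y powr (lam + 1) / (lam + 1))" if "y \<ge> 0" for y
  proof -
    have "(\<lambda>m. real m powr (lam + 1) * chord_integral lam (pi * y / real m) / pi)
      \<longlonglongrightarrow> (pi * y) powr (lam + 1) * (2 powr lam / (lam + 1)) / pi"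
      using scaled_limit[OF chord_integral_asymp[OF assms], of y] assms that
      by (intro tendsto_divide tendsto_const) (auto simp: chord_integral_def)
    also have "(pi * y) powr (lam + 1) * (2 powr lam / (lam + 1)) / pi = (2 * pi) powr lam * (y powr (lam + 1) / (lam + 1))"
      using that by (simp add: powr_mult powr_add abs_mult)
    finally show ?thesis .
  qed
  have "(\<lambda>m. (real m powr lam * chord lam (pi * real k / real m) + real m powr lam * chord lam (pi * real (Suc k) / real m)) / 2
      - (real m powr (lam + 1) * chord_integral lam (pi * real (Suc k) / real m) / pi
         - real m powr (lam + 1) * chord_integral lam (pi * real k / real m) / pi))
    \<longlonglongrightarrow> ((2 * pi) powr lam * real k powr lam + (2 * pi) powr lam * real (Suc k) powr lam) / 2
      - ((2 * pi) powr lam * (real (Suc k) powr (lam + 1) / (lam + 1)) - (2 * pi) powr lam * (real k powr (lam + 1) / (lam + 1)))"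
    by (intro tendsto_diff tendsto_divide tendsto_add tendsto_const f P) auto
  moreover have "(real m powr lam * chord lam (pi * real k / real m) + real m powr lam * chord lam (pi * real (Suc k) / real m)) / 2
      - (real m powr (lam + 1) * chord_integral lam (pi * real (Suc k) / real m) / pi
         - real m powr (lam + 1) * chord_integral lam (pi * real k / real m) / pi) = chord_trapezoid_error lam m k" for m
  proof -
    have "real m powr (lam + 1) = real m powr lam * real m" by (simp add: powr_add)
    then show ?thesis
      unfolding chord_trapezoid_error_def by (simp only: right_diff_distrib distrib_left) (simp add: algebra_simps add_divide_distrib)
  qed
  moreover have "((2 * pi) powr lam * real k powr lam + (2 * pi) powr lam * real (Suc k) powr lam) / 2
      - ((2 * pi) powr lam * (real (Suc k) powr (lam + 1) / (lam + 1)) - (2 * pi) powr lam * (real k powr (lam + 1) / (lam + 1)))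
      = (2 * pi) powr lam * powr_trapezoid_error lam k"
    unfolding powr_trapezoid_error_def by (simp add: algebra_simps diff_divide_distrib)
  ultimately show ?thesis by simp
qed

text \<open>Both the sum and the integral are symmetric, so only the cells in \<open>[0, pi / 2]\<close> occur; this is where \<open>m\<close> has to
  be even.\<close>

lemma comb_zero_trapezoid:
  assumes "lam > 0" "h > 0"
  shows "real (2 * h) powr lam * (comb lam (2 * h) 0 - real (2 * h) * (chord_integral lam pi / pi))
    = 2 * (\<Sum>k<h. chord_trapezoid_error lam (2 * h) k)"
proof -
  let ?g = "\<lambda>k. chord lam (pi * real k / real (2 * h))"
  let ?Q = "\<lambda>k. chord_integral lam (pi * real k / real (2 * h))"
  have sym: "?g (h + i) = ?g (h - i)" if "i \<le> h" for i
  proof -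
    have "pi * real (h + i) / real (2 * h) = - (pi * real (h - i) / real (2 * h)) + pi"
      using that assms by (simp add: of_nat_diff field_simps)
    then show ?thesis by (simp only: chord_plus_pi chord_minus)
  qed
  have "comb lam (2 * h) 0 = (\<Sum>k<h. ?g k) + (\<Sum>k<h. ?g (h + k))"
    using sum_lessThan_add[of ?g h h] by (simp only: comb_def mult_2 add_0)
  also have "(\<Sum>k<h. ?g (h + k)) = (\<Sum>k<h. ?g (h - k))"
    by (intro sum.cong refl sym) auto
  also have "\<dots> = (\<Sum>k<h. ?g (Suc k))"
    using sum.nat_diff_reindex[of "\<lambda>k. ?g (Suc k)" h] by (auto intro!: sum.cong simp: Suc_diff_Suc)
  finally have 1: "comb lam (2 * h) 0 = (\<Sum>k<h. ?g k + ?g (Suc k))" by (simp only: sum.distrib)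
  have "(\<Sum>k<h. ?Q (Suc k) - ?Q k) = ?Q h - ?Q 0" by (rule sum_lessThan_telescope)
  also have "\<dots> = chord_integral lam (pi / 2)" using assms by (simp add: chord_integral_def)
  finally have 2: "(\<Sum>k<h. ?Q (Suc k) - ?Q k) = chord_integral lam pi / 2"
    using chord_integral_half[OF assms(1)] by simp
  have "2 * (\<Sum>k<h. chord_trapezoid_error lam (2 * h) k)
      = real (2 * h) powr lam * ((\<Sum>k<h. ?g k + ?g (Suc k)) - 2 * (real (2 * h) / pi) * (\<Sum>k<h. ?Q (Suc k) - ?Q k))"
    unfolding chord_trapezoid_error_def sum_distrib_left[symmetric] sum_subtractf sum_divide_distrib[symmetric]
    by (simp add: algebra_simps)
  then show ?thesis unfolding 1[symmetric] 2 by simp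
qed

text \<open>Each scaled cell error converges to the error for \<open>(2 * pi * x) powr lam\<close>, and the errors are dominated by a
  multiple of \<open>k powr (lam - 2)\<close>, so Tannery's theorem applies. The two ends of the period produce the factor \<open>2\<close>.\<close>

theorem comb_asymptotics:
  assumes lam: "0 < lam" "lam < 1"
  shows "(\<lambda>h. real (2 * h) powr lam * (comb lam (2 * h) 0 - real (2 * h) * (chord_integral lam pi / pi)))
    \<longlonglongrightarrow> zeta_const lam"
proof -
  define M where "M k = 4 * pi\<^sup>2 * pi powr (lam - 2) * real k powr (lam - 2)" for k
  \<comment> \<open>Padding with zeros turns the finite sums into series over a fixed index set.\<close>
  define a where "a k h = (if k < h then chord_trapezoid_error lam (2 * h) k else 0)" for k h
  let ?b = "\<lambda>k. (2 * pi) powr lam * powr_trapezoid_error lam k"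
  have "(\<lambda>h. a k h) \<longlonglongrightarrow> ?b k" for k
  proof -
    have "(\<lambda>h. chord_trapezoid_error lam (2 * h) k) \<longlonglongrightarrow> ?b k"
      by (rule LIMSEQ_subseq_LIMSEQ[OF chord_trapezoid_error_limit[OF lam(1)], unfolded o_def])
         (auto simp: strict_mono_def)
    moreover have "\<forall>\<^sub>F h in sequentially. chord_trapezoid_error lam (2 * h) k = a k h"
      using eventually_gt_at_top[of k] by eventually_elim (simp add: a_def)
    ultimately show ?thesis by (rule Lim_transform_eventually)
  qed
  moreover have "norm (a k h) \<le> M k" if k: "k \<ge> 1" for k h
  proof (cases "k < h")
    case True
    then show ?thesis
      using chord_trapezoid_error_bound[OF lam k, of "2 * h"] by (simp add: a_def M_def)
  qed (simp add: a_def M_def)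
  then have "\<forall>\<^sub>F (k, h) in sequentially \<times>\<^sub>F sequentially. norm (a k h) \<le> M k"
    unfolding eventually_prod_sequentially by fastforce
  moreover have "summable M"
    unfolding M_def using lam by (intro summable_mult) (simp only: summable_real_powr_iff)
  ultimately have "(\<lambda>h. \<Sum>k. a k h) \<longlonglongrightarrow> (\<Sum>k. ?b k)"
    using tannerys_theorem[of a ?b sequentially M] by (simp del: of_nat_Suc)
  moreover have "(\<Sum>k. ?b k) = (2 * pi) powr lam * (\<Sum>k. powr_trapezoid_error lam k)"
    by (rule suminf_mult[OF summable_powr_trapezoid_error[OF lam]])
  ultimately have "(\<lambda>h. 2 * (\<Sum>k. a k h)) \<longlonglongrightarrow> zeta_const lam"
    unfolding zeta_const_def riemann_zeta_neg[OF lam] using tendsto_mult_left[of "\<lambda>h. \<Sum>k. a k h" _ _ 2]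
    by (simp add: mult_ac)
  moreover have "\<forall>\<^sub>F h in sequentially. 2 * (\<Sum>k. a k h)
      = real (2 * h) powr lam * (comb lam (2 * h) 0 - real (2 * h) * (chord_integral lam pi / pi))"
    using eventually_gt_at_top[of 0]
  proof eventually_elim
    case (elim h)
    have "(\<Sum>k. a k h) = (\<Sum>k<h. a k h)"
      by (rule suminf_finite) (auto simp: a_def)
    also have "\<dots> = (\<Sum>k<h. chord_trapezoid_error lam (2 * h) k)" by (simp add: a_def)
    finally show ?case using comb_zero_trapezoid[OF lam(1) elim] by simp
  qed
  ultimately show ?thesis by (rule Lim_transform_eventually)
qed

section \<open>Binary expansions and the normalised energy\<close>

text \<open>The coefficient of the zeta constant in \<^const>\<open>block_energy\<close>. Divided by \<open>binary_value es powr (1 - lam)\<close> it is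
  the value of \<^const>\<open>G\<close> at the normalised digits.\<close>

primrec block_scale :: "real \<Rightarrow> nat list \<Rightarrow> real" where
  "block_scale lam [] = 0"
| "block_scale lam (e # es) = (2 ^ e) powr (- lam) * (2 ^ e + 2 * (2 powr (- lam) - 1) * real (binary_value es))
     + block_scale lam es"

text \<open>The difference of the two sides vanishes at \<open>0\<close> and \<open>1\<close> and has a decreasing derivative on the interior, so it
  is nonnegative. The mean value theorem is used in place of concavity because the derivative
  is unbounded at \<open>0\<close>.\<close>

lemma powr_sum_concave_bound:
  fixes t lam :: real
  assumes lam: "0 < lam" "lam < 1" and t: "0 \<le> t" "t \<le> 1"
  shows "(1 + t) powr (1 - lam) \<le> 1 - (2 - 2 powr (1 - lam)) * t + t powr (1 - lam)"
proof -
  define c where "c = 2 - 2 powr (1 - lam)"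
  define \<phi> where "\<phi> t = 1 - c * t + t powr (1 - lam) - (1 + t) powr (1 - lam)" for t :: real
  define g where "g t = t powr (- lam) - (1 + t) powr (- lam)" for t :: real
  have d: "(\<phi> has_real_derivative - c + (1 - lam) * g x) (at x)" if "0 < x" for x
    unfolding \<phi>_def g_def using that by (auto intro!: derivative_eq_intros simp: algebra_simps)
  have g_mono: "g z \<le> g y" if "0 < y" "y \<le> z" for y z
  proof (rule DERIV_nonpos_imp_nonincreasing[OF that(2)])
    fix x assume x: "y \<le> x" "x \<le> z"
    have "(g has_real_derivative - lam * (x powr (- lam - 1) - (1 + x) powr (- lam - 1))) (at x)"
      unfolding g_def using x that by (auto intro!: derivative_eq_intros simp: algebra_simps)
    moreover have "(1 + x) powr (- lam - 1) \<le> x powr (- lam - 1)"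
      using x that lam by (intro powr_mono2') auto
    then have "- lam * (x powr (- lam - 1) - (1 + x) powr (- lam - 1)) \<le> 0"
      using lam by (intro mult_nonpos_nonneg) auto
    ultimately show "\<exists>y. (g has_real_derivative y) (at x) \<and> y \<le> 0" by blast
  qed
  have cont: "continuous_on {a..b} \<phi>" if "0 \<le> a" for a b
    unfolding \<phi>_def using that lam by (intro continuous_intros continuous_on_powr') auto
  have mvt: "\<exists>z. a < z \<and> z < b \<and> \<phi> b - \<phi> a = (b - a) * (- c + (1 - lam) * g z)" if "0 \<le> a" "a < b" for a b
  proof -
    have "\<phi> differentiable (at x)" if "a < x" for x
    proof -
      have "0 < x" using that \<open>0 \<le> a\<close> by linarith
      from d[OF this] show ?thesis using real_differentiable_def by blast
    qed
    then obtain l z where z: "a < z" "z < b" "(\<phi> has_real_derivative l) (at z)" "\<phi> b - \<phi> a = (b - a) * l"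
      using MVT[OF \<open>a < b\<close> cont[OF \<open>0 \<le> a\<close>]] by blast
    moreover have "l = - c + (1 - lam) * g z"
      using DERIV_unique[OF z(3) d] z(1) \<open>0 \<le> a\<close> by simp
    ultimately show ?thesis by blast
  qed
  have "\<phi> 0 = 0" "\<phi> 1 = 0" using lam by (simp_all add: \<phi>_def c_def)
  have "\<phi> t \<ge> 0"
  proof (rule ccontr)
    \<comment> \<open>A negative value forces a negative slope before \<open>t\<close> and a positive slope after it.\<close>
    assume neg: "\<not> \<phi> t \<ge> 0"
    then have "0 < t" "t < 1" using t \<open>\<phi> 0 = 0\<close> \<open>\<phi> 1 = 0\<close> by (auto simp: less_le)
    obtain y where y: "0 < y" "y < t" "\<phi> t - \<phi> 0 = (t - 0) * (- c + (1 - lam) * g y)"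
      using mvt[of 0 t] \<open>0 < t\<close> by auto
    obtain z where z: "t < z" "z < 1" "\<phi> 1 - \<phi> t = (1 - t) * (- c + (1 - lam) * g z)"
      using mvt[of t 1] \<open>0 < t\<close> \<open>t < 1\<close> by auto
    have "- c + (1 - lam) * g y < 0"
      using y(3) neg \<open>\<phi> 0 = 0\<close> \<open>0 < t\<close> by (simp add: mult_less_0_iff not_le)
    moreover have "- c + (1 - lam) * g z > 0"
    proof (rule zero_less_mult_pos)
      show "0 < (1 - t) * (- c + (1 - lam) * g z)"
        using z(3) neg \<open>\<phi> 1 = 0\<close> by linarith
    qed (use \<open>t < 1\<close> in simp)
    moreover have "(1 - lam) * g z \<le> (1 - lam) * g y"
      using g_mono[of y z] y z lam by (intro mult_left_mono) auto
    ultimately show False by linarith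
  qed
  then show ?thesis by (simp add: \<phi>_def c_def)
qed

text \<open>Removing the largest digit \<open>m\<close> leaves \<open>V \<le> m\<close>, and the step is the preceding inequality with \<open>t = V / m\<close>.\<close>

lemma block_scale_ge:
  assumes lam: "0 < lam" "lam < 1"
  shows "sorted_wrt (>) es \<Longrightarrow> real (binary_value es) powr (1 - lam) \<le> block_scale lam es"
proof (induction es)
  case (Cons e es)
  define m :: real where "m = 2 ^ e"
  define V where "V = real (binary_value es)"
  have m: "m > 0" by (simp add: m_def)
  have "binary_value es < 2 ^ e" using Cons.prems binary_value_less[of es e] by auto
  then have "V \<le> real (2 ^ e)" unfolding V_def by (simp only: of_nat_le_iff less_imp_le)
  then have V: "0 \<le> V" "V \<le> m" by (simp_all add: V_def m_def)
  have "(m + V) powr (1 - lam) = (m * (1 + V / m)) powr (1 - lam)"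
    using m by (simp add: distrib_left)
  also have "\<dots> = m powr (1 - lam) * (1 + V / m) powr (1 - lam)" by (rule powr_mult)
  also have "\<dots> \<le> m powr (1 - lam) * (1 - (2 - 2 powr (1 - lam)) * (V / m) + (V / m) powr (1 - lam))"
    using V m by (intro mult_left_mono powr_sum_concave_bound lam) auto
  also have "\<dots> = m powr (- lam) * (m + 2 * (2 powr (- lam) - 1) * V) + V powr (1 - lam)"
  proof -
    have "m powr (1 - lam) = m powr (- lam) * m" "2 powr (1 - lam) = 2 * 2 powr (- lam)"
      using m powr_add[of m "- lam" 1] powr_add[of 2 "- lam" 1] by simp_all
    moreover have "m powr (1 - lam) * (V / m) powr (1 - lam) = V powr (1 - lam)"
      using m V by (simp add: powr_divide)
    ultimately show ?thesis using m by (simp add: algebra_simps)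
  qed
  also have "\<dots> \<le> block_scale lam (e # es)"
    using Cons by (simp add: V_def m_def)
  finally show ?case by (simp add: V_def m_def)
qed simp

lemma power_two_powr: "(2 ^ e) powr x = (2 powr x :: real) ^ e"
proof -
  have "(2 ^ e) powr x = (2 powr real e :: real) powr x" by (simp only: powr_realpow zero_less_numeral)
  also have "\<dots> = (2 powr x) powr real e" by (simp only: powr_powr mult.commute)
  also have "\<dots> = (2 powr x) ^ e" by (rule powr_realpow) simp
  finally show ?thesis .
qed

text \<open>The interaction terms are negative; what remains is at most a geometric series.\<close>

lemma block_scale_le:
  assumes lam: "0 < lam" "lam < 1"
  shows "sorted_wrt (>) es \<Longrightarrow> (\<And>e. e \<in> set es \<Longrightarrow> e < n)
    \<Longrightarrow> block_scale lam es \<le> (2 powr (1 - lam)) ^ n / (2 powr (1 - lam) - 1)"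
proof (induction es arbitrary: n)
  case Nil
  have "2 powr (1 - lam) > 1" using lam by simp
  then show ?case by simp
next
  case (Cons e es)
  define q where "q = 2 powr (1 - lam)"
  have q: "q > 1" using lam by (simp add: q_def)
  have "block_scale lam es \<le> q ^ e / (q - 1)"
    using Cons.prems unfolding q_def by (intro Cons.IH) auto
  moreover have "(2 ^ e) powr (- lam) * (2 ^ e + 2 * (2 powr (- lam) - 1) * real (binary_value es)) \<le> (2 ^ e) powr (- lam) * 2 ^ e"
  proof (intro mult_left_mono)
    have "(2 powr (- lam) - 1) * real (binary_value es) \<le> 0"
      using lam powr_le_one_le[of 2] powr_mono[of "- lam" 0 2] by (intro mult_nonpos_nonneg) auto
    then show "2 ^ e + 2 * (2 powr (- lam) - 1) * real (binary_value es) \<le> 2 ^ e"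
      unfolding mult.assoc by linarith
  qed simp
  moreover have "(2 ^ e) powr (- lam) * 2 ^ e = q ^ e"
    unfolding q_def using powr_add[of "2 ^ e" "- lam" 1]
    by (simp add: power_two_powr[symmetric])
  moreover have "q ^ e + q ^ e / (q - 1) = q ^ Suc e / (q - 1)"
    using q by (simp add: field_simps)
  moreover have "q ^ Suc e / (q - 1) \<le> q ^ n / (q - 1)"
    using q Cons.prems(2)[of e] by (intro divide_right_mono power_increasing) auto
  ultimately show ?case unfolding q_def by simp
qed

lemma block_scale_le_powr:
  assumes lam: "0 < lam" "lam < 1" and es: "sorted_wrt (>) es"
  shows "block_scale lam es \<le> 2 powr (1 - lam) / (2 powr (1 - lam) - 1) * real (binary_value es) powr (1 - lam)"
proof (cases es)
  case (Cons e es')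
  define q where "q = 2 powr (1 - lam)"
  have q: "q > 1" using lam by (simp add: q_def)
  have "block_scale lam es \<le> q ^ Suc e / (q - 1)"
    using es Cons unfolding q_def by (intro block_scale_le[OF lam es]) (auto simp: less_Suc_eq)
  also have "\<dots> = q / (q - 1) * q ^ e" by simp
  also have "\<dots> \<le> q / (q - 1) * real (binary_value es) powr (1 - lam)"
  proof (intro mult_left_mono)
    have "q ^ e = real (2 ^ e) powr (1 - lam)" by (simp add: q_def power_two_powr)
    also have "\<dots> \<le> real (binary_value es) powr (1 - lam)"
      using lam Cons by (intro powr_mono2) auto
    finally show "q ^ e \<le> real (binary_value es) powr (1 - lam)" .
  qed (use q in auto)
  finally show ?thesis by (simp add: q_def)
qed simp

definition comb_ratio :: "real \<Rightarrow> nat \<Rightarrow> real" where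
  "comb_ratio lam n = (2 ^ n) powr lam * (comb lam (2 ^ n) 0 - 2 ^ n * (chord_integral lam pi / pi))"

lemma comb_ratio_limit:
  assumes "0 < lam" "lam < 1"
  shows "comb_ratio lam \<longlonglongrightarrow> zeta_const lam"
proof (rule LIMSEQ_imp_Suc)
  have "(\<lambda>n. real (2 * 2 ^ n) powr lam * (comb lam (2 * 2 ^ n) 0 - real (2 * 2 ^ n) * (chord_integral lam pi / pi)))
    \<longlonglongrightarrow> zeta_const lam"
    by (rule LIMSEQ_subseq_LIMSEQ[OF comb_asymptotics[OF assms], unfolded o_def]) (auto simp: strict_mono_def)
  then show "(\<lambda>n. comb_ratio lam (Suc n)) \<longlonglongrightarrow> zeta_const lam"
    by (simp add: comb_ratio_def)
qed

definition digit_error :: "real \<Rightarrow> nat \<Rightarrow> real" where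
  "digit_error lam e = 3 * \<bar>comb_ratio lam e - zeta_const lam\<bar> + 2 * \<bar>comb_ratio lam (Suc e) - zeta_const lam\<bar>"

lemma digit_error_limit:
  assumes "0 < lam" "lam < 1"
  shows "digit_error lam \<longlonglongrightarrow> 0"
proof -
  have "(\<lambda>e. comb_ratio lam e - zeta_const lam) \<longlonglongrightarrow> 0"
    using comb_ratio_limit[OF assms] by (simp add: LIM_zero_iff)
  moreover from this have "(\<lambda>e. comb_ratio lam (Suc e) - zeta_const lam) \<longlonglongrightarrow> 0"
    by (rule LIMSEQ_Suc)
  ultimately have "(\<lambda>e. 3 * \<bar>comb_ratio lam e - zeta_const lam\<bar> + 2 * \<bar>comb_ratio lam (Suc e) - zeta_const lam\<bar>) \<longlonglongrightarrow> 3 * \<bar>0\<bar> + 2 * \<bar>0\<bar>"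
    by (intro tendsto_add tendsto_mult tendsto_rabs tendsto_const)
  then show ?thesis by (simp add: digit_error_def[abs_def])
qed

lemma comb_eq_ratio: "comb lam (2 ^ e) 0 = 2 ^ e * (chord_integral lam pi / pi) + (2 ^ e) powr (- lam) * comb_ratio lam e"
  by (simp add: comb_ratio_def powr_minus field_simps)

text \<open>The leading terms add up to the square of the value, as \<open>(m + V)\<^sup>2 = m\<^sup>2 + 2 * m * V + V\<^sup>2\<close> when the digit
  \<open>m\<close> is followed by \<open>V\<close>. Since \<open>V \<le> m\<close>, every digit contributes at most its error times \<open>m powr (1 - lam)\<close>.\<close>

lemma block_energy_approx:
  assumes lam: "0 < lam"
  shows "sorted_wrt (>) es \<Longrightarrow>
    \<bar>block_energy lam es - real (binary_value es) ^ 2 * (chord_integral lam pi / pi) - zeta_const lam * block_scale lam es\<bar>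
    \<le> (\<Sum>e\<leftarrow>es. (2 powr (1 - lam)) ^ e * digit_error lam e)"
proof (induction es)
  case (Cons e es)
  define m :: real where "m = 2 ^ e"
  define V where "V = real (binary_value es)"
  define J where "J = chord_integral lam pi / pi"
  define C where "C = zeta_const lam"
  define R where "R = comb_ratio lam e"
  define R' where "R' = comb_ratio lam (Suc e)"
  define s where "s = 2 powr (- lam)"
  define \<mu> where "\<mu> = m powr (- lam)"
  have s: "0 \<le> s" "s \<le> 1" using lam powr_mono[of "- lam" 0 2] by (simp_all add: s_def)
  have "binary_value es < 2 ^ e" using Cons.prems binary_value_less[of es e] by auto
  then have "V \<le> real (2 ^ e)" unfolding V_def by (simp only: of_nat_le_iff less_imp_le)
  then have V: "0 \<le> V" "V \<le> m" by (simp_all add: V_def m_def)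
  have S: "comb lam (2 ^ e) 0 = m * J + \<mu> * R"
    by (simp only: comb_eq_ratio m_def J_def R_def \<mu>_def)
  have S': "comb lam (2 * 2 ^ e) 0 = 2 * m * J + s * \<mu> * R'"
    using comb_eq_ratio[of lam "Suc e"] by (simp add: m_def J_def R'_def \<mu>_def s_def powr_mult)
  have *: "\<bar>block_energy lam es - V\<^sup>2 * J - C * block_scale lam es\<bar>
      \<le> (\<Sum>e\<leftarrow>es. (2 powr (1 - lam)) ^ e * digit_error lam e)"
    using Cons unfolding V_def J_def C_def by simp
  \<comment> \<open>The contribution of the largest digit once the leading term and its multiple of \<open>C\<close> are removed.\<close>
  define D where "D = \<mu> * (m * (R - C) + 2 * V * (s * (R' - C) - (R - C)))"
  have "block_energy lam (e # es) - real (binary_value (e # es)) ^ 2 * J - C * block_scale lam (e # es)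
      = D + (block_energy lam es - V\<^sup>2 * J - C * block_scale lam es)"
  proof -
    have "block_energy lam (e # es) = m * (m * J + \<mu> * R) + 2 * V * ((2 * m * J + s * \<mu> * R') - (m * J + \<mu> * R)) + block_energy lam es"
      by (simp add: S S' V_def m_def)
    moreover have "block_scale lam (e # es) = \<mu> * (m + 2 * (s - 1) * V) + block_scale lam es"
      by (simp add: \<mu>_def m_def s_def V_def)
    moreover have "real (binary_value (e # es)) = m + V" by (simp add: m_def V_def)
    ultimately show ?thesis unfolding D_def
      by (simp only: power2_eq_square) (simp add: algebra_simps)
  qed
  moreover have "\<bar>D\<bar> \<le> (2 powr (1 - lam)) ^ e * digit_error lam e"
  proof -
    have "\<bar>s * (R' - C) - (R - C)\<bar> \<le> 1 * \<bar>R' - C\<bar> + \<bar>R - C\<bar>"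
      using s abs_triangle_ineq4[of "s * (R' - C)" "R - C"] mult_right_mono[of s 1 "\<bar>R' - C\<bar>"]
      by (simp add: abs_mult)
    then have "2 * V * \<bar>s * (R' - C) - (R - C)\<bar> \<le> 2 * m * (\<bar>R' - C\<bar> + \<bar>R - C\<bar>)"
      using V by (intro mult_mono) auto
    moreover have "\<bar>m * (R - C) + 2 * V * (s * (R' - C) - (R - C))\<bar>
        \<le> m * \<bar>R - C\<bar> + 2 * V * \<bar>s * (R' - C) - (R - C)\<bar>"
      using V by (intro order_trans[OF abs_triangle_ineq]) (simp add: abs_mult)
    ultimately have "\<bar>m * (R - C) + 2 * V * (s * (R' - C) - (R - C))\<bar> \<le> m * (3 * \<bar>R - C\<bar> + 2 * \<bar>R' - C\<bar>)"
      by (simp add: algebra_simps)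
    then have "\<mu> * \<bar>m * (R - C) + 2 * V * (s * (R' - C) - (R - C))\<bar> \<le> \<mu> * (m * (3 * \<bar>R - C\<bar> + 2 * \<bar>R' - C\<bar>))"
      by (intro mult_left_mono) (simp_all add: \<mu>_def)
    moreover have "\<mu> * m = (2 powr (1 - lam)) ^ e"
      using powr_add[of m "- lam" 1] by (simp add: \<mu>_def m_def power_two_powr[symmetric])
    ultimately show ?thesis
      by (simp add: D_def abs_mult \<mu>_def digit_error_def R_def R'_def C_def mult.assoc[symmetric])
  qed
  ultimately show ?case
    using * unfolding J_def[symmetric] C_def[symmetric] list.map sum_list.Cons by linarith
qed simp

text \<open>Weighted by a growing geometric sequence, the last terms dominate, so a null sequence has null averages.\<close>

lemma geometric_average_null:
  fixes \<epsilon> :: "nat \<Rightarrow> real"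
  assumes q: "q > 1" and lim: "\<epsilon> \<longlonglongrightarrow> 0"
  shows "(\<lambda>n. (\<Sum>i\<le>n. q ^ i * \<epsilon> i) / q ^ n) \<longlonglongrightarrow> 0"
proof -
  obtain B where B: "\<And>n. \<bar>\<epsilon> n\<bar> \<le> B"
    using convergent_imp_Bseq[OF convergentI[OF lim]] unfolding Bseq_def by auto
  \<comment> \<open>Counting from the last term backwards, the weights become \<open>(1 / q) ^ i\<close> and no longer depend on \<open>n\<close>.\<close>
  define a where "a i n = (if i \<le> n then \<epsilon> (n - i) * (1 / q) ^ i else 0)" for i n
  have "(\<lambda>n. a i n) \<longlonglongrightarrow> 0" for i
  proof (rule LIMSEQ_offset[where k = i])
    have "(\<lambda>n. \<epsilon> n * (1 / q) ^ i) \<longlonglongrightarrow> 0 * (1 / q) ^ i"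
      by (intro tendsto_mult lim tendsto_const)
    then show "(\<lambda>n. a i (n + i)) \<longlonglongrightarrow> 0" by (simp add: a_def)
  qed
  moreover have "norm (a i n) \<le> B * (1 / q) ^ i" for i n
    using B[of "n - i"] order_trans[OF abs_ge_zero B] q
    by (auto simp: a_def abs_mult intro!: mult_right_mono)
  then have "\<forall>\<^sub>F (i, n) in sequentially \<times>\<^sub>F sequentially. norm (a i n) \<le> B * (1 / q) ^ i"
    by (intro always_eventually) auto
  moreover have "summable (\<lambda>i. B * (1 / q) ^ i)"
    using q by (intro summable_mult summable_geometric) simp
  ultimately have "(\<lambda>n. \<Sum>i. a i n) \<longlonglongrightarrow> (\<Sum>i. 0)"
    using tannerys_theorem[of a "\<lambda>_. 0" sequentially "\<lambda>i. B * (1 / q) ^ i"] by simp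
  moreover have "(\<Sum>i. a i n) = (\<Sum>i\<le>n. q ^ i * \<epsilon> i) / q ^ n" for n
  proof -
    have "(\<Sum>i. a i n) = (\<Sum>i\<le>n. a i n)"
      by (rule suminf_finite) (auto simp: a_def)
    also have "\<dots> = (\<Sum>i\<le>n. a (n - i) n)"
      by (subst sum.nat_diff_reindex[symmetric, of _ "Suc n", simplified lessThan_Suc_atMost])
         (auto intro!: sum.cong)
    also have "\<dots> = (\<Sum>i\<le>n. q ^ i * \<epsilon> i / q ^ n)"
    proof (intro sum.cong refl)
      fix i assume "i \<in> {..n}"
      then show "a (n - i) n = q ^ i * \<epsilon> i / q ^ n"
        using q by (simp add: a_def power_divide power_diff)
    qed
    finally show ?thesis by (simp add: sum_divide_distrib)
  qed
  ultimately show ?thesis by simp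
qed

lemma block_energy_asymptotics:
  assumes lam: "0 < lam" "lam < 1" and \<epsilon>: "\<epsilon> > 0"
  shows "\<exists>N0. \<forall>es. sorted_wrt (>) es \<longrightarrow> N0 \<le> binary_value es \<longrightarrow>
    \<bar>block_energy lam es - real (binary_value es) ^ 2 * (chord_integral lam pi / pi) - zeta_const lam * block_scale lam es\<bar>
    \<le> \<epsilon> * real (binary_value es) powr (1 - lam)"
proof -
  define q where "q = 2 powr (1 - lam)"
  have q: "q > 1" using lam by (simp add: q_def)
  have nn: "digit_error lam i \<ge> 0" for i by (simp add: digit_error_def)
  have "\<forall>\<^sub>F n in sequentially. (\<Sum>i\<le>n. q ^ i * digit_error lam i) / q ^ n < \<epsilon>"
    using geometric_average_null[OF q digit_error_limit[OF lam]] \<epsilon> by (rule order_tendstoD)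
  then obtain n0 where n0: "\<And>n. n \<ge> n0 \<Longrightarrow> (\<Sum>i\<le>n. q ^ i * digit_error lam i) / q ^ n < \<epsilon>"
    by (auto simp: eventually_sequentially)
  show ?thesis
  proof (intro exI[of _ "2 ^ n0 :: nat"] allI impI)
    fix es assume es: "sorted_wrt (>) es" and N: "2 ^ n0 \<le> binary_value es"
    then obtain n es' where Cons: "es = n # es'" by (cases es) auto
    have n: "n0 \<le> n"
    proof -
      have "binary_value es < 2 ^ Suc n"
        using es Cons by (intro binary_value_less) (auto simp: less_Suc_eq)
      with N have "(2::nat) ^ n0 < 2 ^ Suc n" by linarith
      then have "n0 < Suc n" by (rule power_less_imp_less_exp[rotated]) simp
      then show ?thesis by simp
    qed
    have "distinct es" using es by (induction es) auto
    then have "(\<Sum>e\<leftarrow>es. q ^ e * digit_error lam e) = (\<Sum>e\<in>set es. q ^ e * digit_error lam e)"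
      by (rule sum_list_distinct_conv_sum_set)
    also have "\<dots> \<le> (\<Sum>e\<le>n. q ^ e * digit_error lam e)"
      using es Cons q nn by (intro sum_mono2) auto
    also have "\<dots> \<le> \<epsilon> * q ^ n"
      using n0[OF n] q by (simp add: pos_divide_less_eq)
    also have "q ^ n = real (2 ^ n) powr (1 - lam)" by (simp add: q_def power_two_powr)
    also have "\<epsilon> * \<dots> \<le> \<epsilon> * real (binary_value es) powr (1 - lam)"
      using lam Cons \<epsilon> by (intro mult_left_mono powr_mono2) auto
    finally show "\<bar>block_energy lam es - real (binary_value es) ^ 2 * (chord_integral lam pi / pi)
        - zeta_const lam * block_scale lam es\<bar> \<le> \<epsilon> * real (binary_value es) powr (1 - lam)"
      using block_energy_approx[OF lam(1) es] unfolding q_def by linarith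
  qed
qed

section \<open>Limits along binary expansions\<close>

lemma greedy_seq_angles:
  assumes "greedy_energy_seq lam a"
  obtains y where "\<And>N. H_energy lam N a = chord_energy lam y N" "\<And>K. greedy_upto lam y K"
proof -
  define y where "y n = Arg (a n) / 2" for n
  have a: "a n = cis (2 * y n)" for n
  proof -
    have "norm (a n) = 1" using assms by (simp add: greedy_energy_seq_def unit_circle_def)
    then have "a n \<noteq> 0" "sgn (a n) = a n" by (auto simp: sgn_eq)
    then show ?thesis using cis_Arg[of "a n"] by (simp add: y_def)
  qed
  have "H_energy lam N a = chord_energy lam y N" for N
    unfolding H_energy_def chord_energy_def
  proof (rule sum.cong[OF refl])
    fix i assume "i \<in> {..<N}"
    show "(\<Sum>j\<in>{..<N} - {i}. dist (a i) (a j) powr lam) = (\<Sum>j<N. chord lam (y i - y j))"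
      unfolding a dist_cis_powr by (rule sum.mono_neutral_left) auto
  qed
  moreover have "greedy_upto lam y K" for K
    unfolding greedy_upto_def
  proof (intro allI impI)
    fix n z assume "n \<ge> (1::nat)"
    moreover have "cis (2 * z) \<in> unit_circle" by (simp add: unit_circle_def)
    ultimately have "(\<Sum>k<n. dist (cis (2 * z)) (a k) powr lam) \<le> (\<Sum>k<n. dist (a n) (a k) powr lam)"
      using assms unfolding greedy_energy_seq_def by blast
    then show "(\<Sum>k<n. chord lam (z - y k)) \<le> (\<Sum>k<n. chord lam (y n - y k))"
      unfolding a dist_cis_powr .
  qed
  ultimately show ?thesis by (rule that)
qed

text \<open>Stated for all expansions with large value rather than for a sequence, so that it applies both to
  all integers and to the sequences that define \<^const>\<open>Theta\<close>.\<close>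

lemma normalized_energy_asymptotics:
  assumes lam: "0 < lam" "lam < 1" and g: "greedy_energy_seq lam a" and \<epsilon>: "\<epsilon> > 0"
  shows "\<exists>N0. \<forall>es. sorted_wrt (>) es \<longrightarrow> N0 \<le> binary_value es \<longrightarrow>
    \<bar>normalized_energy lam a (binary_value es)
      - zeta_const lam * (block_scale lam es / real (binary_value es) powr (1 - lam))\<bar> \<le> \<epsilon>"
proof -
  obtain y where H: "\<And>N. H_energy lam N a = chord_energy lam y N" and gy: "\<And>K. greedy_upto lam y K"
    using greedy_seq_angles[OF g] by blast
  obtain N0 where N0: "\<And>es. sorted_wrt (>) es \<Longrightarrow> N0 \<le> binary_value es \<Longrightarrow>
    \<bar>block_energy lam es - real (binary_value es) ^ 2 * (chord_integral lam pi / pi) - zeta_const lam * block_scale lam es\<bar>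
    \<le> \<epsilon> * real (binary_value es) powr (1 - lam)"
    using block_energy_asymptotics[OF lam \<epsilon>] by blast
  show ?thesis
  proof (intro exI[of _ "max 1 N0"] allI impI)
    fix es assume es: "sorted_wrt (>) es" and N: "max 1 N0 \<le> binary_value es"
    define w where "w = real (binary_value es) powr (1 - lam)"
    have w: "w > 0" using N by (simp add: w_def)
    define E where "E = block_energy lam es - real (binary_value es) ^ 2 * (chord_integral lam pi / pi)"
    have "normalized_energy lam a (binary_value es) = E / w"
      unfolding normalized_energy_def H greedy_energy_binary[OF lam es gy] I_energy_sigma1[OF lam(1)]
        E_def w_def chord_integral_def ..
    then have "normalized_energy lam a (binary_value es) - zeta_const lam * (block_scale lam es / w)
        = (E - zeta_const lam * block_scale lam es) / w"
      by (simp add: diff_divide_distrib)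
    moreover have "\<bar>(E - zeta_const lam * block_scale lam es) / w\<bar> \<le> \<epsilon>"
      using N0[OF es] N w unfolding E_def w_def[symmetric] by (simp add: abs_divide pos_divide_le_eq)
    ultimately show "\<bar>normalized_energy lam a (binary_value es)
      - zeta_const lam * (block_scale lam es / real (binary_value es) powr (1 - lam))\<bar> \<le> \<epsilon>"
      unfolding w_def by simp
  qed
qed

lemma binary_value_map: "binary_value (map e [i..<Suc p]) = (\<Sum>j=i..p. 2 ^ e j)"
proof (induction "Suc p - i" arbitrary: i)
  case (Suc n)
  then have i: "i \<le> p" by simp
  have "binary_value (map e [Suc i..<Suc p]) = (\<Sum>j=Suc i..p. 2 ^ e j)"
    using Suc by (intro Suc.hyps(1)) simp
  with i show ?case by (simp add: upt_conv_Cons sum.atLeast_Suc_atMost del: upt_Suc)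
qed simp

lemma block_scale_map:
  "block_scale lam (map e [i..<Suc p])
    = (\<Sum>k=i..p. (2 ^ e k) powr (- lam) * (2 ^ e k + 2 * (2 powr (- lam) - 1) * (\<Sum>j=k+1..p. 2 ^ e j)))"
proof (induction "Suc p - i" arbitrary: i)
  case (Suc n)
  then have i: "i \<le> p" by simp
  have "block_scale lam (map e [Suc i..<Suc p]) = (\<Sum>k=Suc i..p. (2 ^ e k) powr (- lam) * (2 ^ e k + 2 * (2 powr (- lam) - 1) * (\<Sum>j=k+1..p. 2 ^ e j)))"
    using Suc by (intro Suc.hyps(1)) simp
  with i show ?case
    by (simp add: upt_conv_Cons binary_value_map sum.atLeast_Suc_atMost[of i p] del: upt_Suc)
qed simp

lemma sorted_map_exponents:
  assumes "\<forall>i\<in>{1..p}. \<forall>j\<in>{1..p}. i < j \<longrightarrow> e j < (e i :: nat)" "1 \<le> i"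
  shows "sorted_wrt (>) (map e [i..<Suc p])"
  unfolding sorted_wrt_map
  by (rule sorted_wrt_mono_rel[OF _ sorted_wrt_upt]) (use assms in auto)

lemma G_eq_block_scale:
  assumes N: "N > (0::real)" and \<theta>: "\<And>i. i \<in> {1..p} \<Longrightarrow> \<theta> i = 2 ^ e i / N"
  shows "G p \<theta> lam = block_scale lam (map e [1..<Suc p]) / N powr (1 - lam)"
proof -
  have "(if \<theta> k = 0 then 0 else \<theta> k powr (-lam) * (2 * (2 powr (-lam) - 1) * (\<Sum>j=k+1..p. \<theta> j) + \<theta> k))
      = (2 ^ e k) powr (- lam) * (2 ^ e k + 2 * (2 powr (- lam) - 1) * (\<Sum>j=k+1..p. 2 ^ e j)) / N powr (1 - lam)"
    if k: "k \<in> {1..p}" for k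
  proof -
    have "(\<Sum>j=k+1..p. \<theta> j) = (\<Sum>j=k+1..p. 2 ^ e j) / N"
      unfolding sum_divide_distrib using k by (intro sum.cong refl \<theta>) auto
    moreover have "\<theta> k \<noteq> 0" using N \<theta>[OF k] by simp
    moreover have "(2 ^ e k / N) powr (- lam) = (2 ^ e k) powr (- lam) / N powr (- lam)"
      using N by (simp add: powr_divide)
    moreover have "N powr (1 - lam) = N powr (- lam) * N"
      using N powr_add[of N "- lam" 1] by simp
    moreover have "w / n * (c * (S / N) + X / N) = w * (X + c * S) / (n * N)" for w n c S X
      by (simp add: add_divide_distrib[symmetric] add.commute)
    ultimately show ?thesis
      by (simp only: \<theta>[OF k] if_False)
  qed
  then show ?thesis
    unfolding G_def block_scale_map sum_divide_distrib by (intro sum.cong refl)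
qed

text \<open>Multiplying an integer by powers of two shifts its exponents and keeps the normalised digits fixed, so these
  digits are themselves a limit vector.\<close>

lemma binary_vector_in_Theta:
  assumes es: "sorted_wrt (>) es" "es \<noteq> []"
  obtains p \<theta> where "p \<ge> 1" "\<theta> \<in> Theta p" "G p \<theta> lam = block_scale lam es / real (binary_value es) powr (1 - lam)"
proof -
  define p where "p = length es"
  define e where "e i = es ! (i - 1)" for i
  define N where "N = real (binary_value es)"
  define \<theta> where "\<theta> = restrict (\<lambda>i. 2 ^ e i / N) {1..p}"
  have map: "map e [1..<Suc p] = es"
    by (rule nth_equalityI) (simp_all add: e_def p_def del: upt_Suc)
  have N: "N > 0"
    using es(2) by (cases es) (auto simp: N_def intro: add_pos_nonneg)
  have dec: "e j < e i" if "i \<in> {1..p}" "j \<in> {1..p}" "i < j" for i j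
  proof -
    have "i - 1 < j - 1" "j - 1 < length es" using that by (auto simp: p_def)
    from sorted_wrt_nth_less[OF es(1) this] show ?thesis by (simp add: e_def)
  qed
  have sum: "(\<Sum>i=1..p. 2 ^ e i) = binary_value es"
    using binary_value_map[of e 1 p] map by simp
  have "\<theta> \<in> Theta p"
    unfolding Theta_def
  proof (intro CollectI conjI)
    show "\<theta> \<in> extensional {1..p}" by (simp add: \<theta>_def)
    let ?N = "\<lambda>m. 2 ^ m * binary_value es"
    let ?e = "\<lambda>m i. m + e i"
    have "strict_mono ?N"
      using N by (intro strict_monoI) (simp add: N_def)
    moreover have "?N m = (\<Sum>i=1..p. 2 ^ ?e m i)" for m
      by (simp add: power_add sum[symmetric] sum_distrib_left)
    moreover have "(\<lambda>m. 2 ^ ?e m i / real (?N m)) \<longlonglongrightarrow> \<theta> i" if "i \<in> {1..p}" for i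
    proof -
      have "2 ^ ?e m i / real (?N m) = \<theta> i" for m
        using that N by (simp add: \<theta>_def N_def power_add)
      then show ?thesis by simp
    qed
    ultimately show "\<exists>(N :: nat \<Rightarrow> nat) (e :: nat \<Rightarrow> nat \<Rightarrow> nat).
       strict_mono N \<and> (\<forall>m. N m = (\<Sum>i=1..p. 2 ^ e m i)) \<and>
       (\<forall>m. \<forall>i\<in>{1..p}. \<forall>j\<in>{1..p}. i < j \<longrightarrow> e m j < e m i) \<and>
       (\<forall>i\<in>{1..p}. (\<lambda>m. 2 ^ e m i / real (N m)) \<longlonglongrightarrow> \<theta> i)"
      using dec by (intro exI[of _ ?N] exI[of _ ?e]) auto
  qed
  moreover have "G p \<theta> lam = block_scale lam es / real (binary_value es) powr (1 - lam)"
    using G_eq_block_scale[OF N, of p \<theta> e lam] by (simp only: map N_def) (simp add: \<theta>_def N_def)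
  moreover have "p \<ge> 1" using es(2) by (cases es) (auto simp: p_def)
  ultimately show ?thesis by (rule that[rotated 1])
qed

text \<open>Continuity of \<^const>\<open>G\<close> is only delicate at a vanishing coordinate, where a negative power blows up. There the
  later digits sum to at most the digit \<open>t\<close> itself, so the term is of order \<open>t powr (1 - lam)\<close>.\<close>

lemma Theta_limit:
  assumes lam: "0 < lam" "lam < 1" and \<theta>: "\<theta> \<in> Theta p"
  obtains es where "\<And>m. sorted_wrt (>) (es m)" "strict_mono (\<lambda>m. binary_value (es m))"
    "(\<lambda>m. block_scale lam (es m) / real (binary_value (es m)) powr (1 - lam)) \<longlonglongrightarrow> G p \<theta> lam"
proof -
  obtain N :: "nat \<Rightarrow> nat" and e :: "nat \<Rightarrow> nat \<Rightarrow> nat" where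
    mono: "strict_mono N" and N: "\<And>m. N m = (\<Sum>i=1..p. 2 ^ e m i)"
    and dec: "\<And>m. \<forall>i\<in>{1..p}. \<forall>j\<in>{1..p}. i < j \<longrightarrow> e m j < e m i"
    and lim: "\<And>i. i \<in> {1..p} \<Longrightarrow> (\<lambda>m. 2 ^ e m i / real (N m)) \<longlonglongrightarrow> \<theta> i"
    using \<theta> unfolding Theta_def by blast
  define es where "es m = map (e m) [1..<Suc p]" for m
  have val: "binary_value (es m) = N m" for m
    unfolding es_def binary_value_map N ..
  have p: "p \<noteq> 0"
  proof
    assume "p = 0"
    then have "N 0 = 0" "N 1 = 0" by (simp_all add: N)
    with strict_monoD[OF mono, of 0 1] show False by simp
  qed
  have Npos: "real (N m) > 0" for m
  proof -
    have "(2::nat) ^ e m 1 \<le> N m" unfolding N using p by (intro member_le_sum) auto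
    moreover have "(0::nat) < 2 ^ e m 1" by simp
    ultimately show ?thesis by linarith
  qed
  define t where "t m i = 2 ^ e m i / real (N m)" for m i
  have tpos: "t m i > 0" for m i using Npos[of m] by (simp add: t_def)
  define s where "s = 2 * (2 powr (- lam) - 1)"
  have tail: "(\<Sum>j=k+1..p. t m j) \<le> t m k" if "k \<in> {1..p}" for k m
  proof -
    have "sorted_wrt (>) (map (e m) [k..<Suc p])" using dec that by (intro sorted_map_exponents) auto
    moreover have "[k..<Suc p] = k # [Suc k..<Suc p]" using that by (intro upt_conv_Cons) auto
    ultimately have "binary_value (map (e m) [Suc k..<Suc p]) < 2 ^ e m k"
      by (intro binary_value_less) (auto simp del: upt_Suc)
    then have "real (\<Sum>j=k+1..p. 2 ^ e m j) \<le> real (2 ^ e m k)"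
      unfolding binary_value_map by (simp only: of_nat_le_iff Suc_eq_plus1 less_imp_le)
    then have "(\<Sum>j=k+1..p. 2 ^ e m j) / real (N m) \<le> 2 ^ e m k / real (N m)"
      using Npos[of m] by (intro divide_right_mono) auto
    then show ?thesis by (simp add: t_def sum_divide_distrib)
  qed
  have conv: "(\<lambda>m. t m k powr (-lam) * (s * (\<Sum>j=k+1..p. t m j) + t m k)) \<longlonglongrightarrow>
      (if \<theta> k = 0 then 0 else \<theta> k powr (-lam) * (s * (\<Sum>j=k+1..p. \<theta> j) + \<theta> k))" if k: "k \<in> {1..p}" for k
  proof (cases "\<theta> k = 0")
    case False
    have "(\<lambda>m. t m k powr (-lam) * (s * (\<Sum>j=k+1..p. t m j) + t m k)) \<longlonglongrightarrow>
        \<theta> k powr (-lam) * (s * (\<Sum>j=k+1..p. \<theta> j) + \<theta> k)"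
      unfolding t_def using False k
      by (intro tendsto_mult tendsto_add tendsto_powr tendsto_sum tendsto_const lim) auto
    with False show ?thesis by simp
  next
    case True
    have "(\<lambda>m. t m k powr (-lam) * (s * (\<Sum>j=k+1..p. t m j) + t m k)) \<longlonglongrightarrow> 0"
    proof (rule Lim_null_comparison)
      have "(\<lambda>m. t m k powr (1 - lam)) \<longlonglongrightarrow> 0 powr (1 - lam)"
        using lim[OF k] True lam tpos
        by (intro tendsto_powr' tendsto_const) (auto simp: t_def[abs_def] less_imp_le)
      then have "(\<lambda>m. t m k powr (1 - lam)) \<longlonglongrightarrow> 0" by simp
      then show "(\<lambda>m. (\<bar>s\<bar> + 1) * t m k powr (1 - lam)) \<longlonglongrightarrow> 0"
        by (rule tendsto_mult_right_zero)
      show "\<forall>\<^sub>F m in sequentially. norm (t m k powr (-lam) * (s * (\<Sum>j=k+1..p. t m j) + t m k))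
          \<le> (\<bar>s\<bar> + 1) * t m k powr (1 - lam)"
      proof (intro always_eventually allI)
        fix m
        have nn: "(\<Sum>j=k+1..p. t m j) \<ge> 0" by (intro sum_nonneg less_imp_le tpos)
        have "\<bar>s * (\<Sum>j=k+1..p. t m j) + t m k\<bar> \<le> \<bar>s\<bar> * (\<Sum>j=k+1..p. t m j) + t m k"
          using nn tpos[of m k] by (intro order_trans[OF abs_triangle_ineq]) (simp add: abs_mult)
        also have "\<dots> \<le> \<bar>s\<bar> * t m k + t m k"
          using tail[OF k, of m] by (intro add_mono mult_left_mono) auto
        finally have "t m k powr (-lam) * \<bar>s * (\<Sum>j=k+1..p. t m j) + t m k\<bar> \<le> t m k powr (-lam) * ((\<bar>s\<bar> + 1) * t m k)"
          by (intro mult_left_mono) (auto simp: algebra_simps)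
        moreover have "t m k powr (1 - lam) = t m k powr (- lam) * t m k"
          using powr_add[of "t m k" "- lam" 1] tpos[of m k] by simp
        ultimately show "norm (t m k powr (-lam) * (s * (\<Sum>j=k+1..p. t m j) + t m k))
          \<le> (\<bar>s\<bar> + 1) * t m k powr (1 - lam)"
          by (simp add: abs_mult mult_ac)
      qed
    qed
    with True show ?thesis by simp
  qed
  have G: "G p (t m) lam = (\<Sum>k=1..p. t m k powr (-lam) * (s * (\<Sum>j=k+1..p. t m j) + t m k))" for m
    unfolding G_def s_def using tpos by (intro sum.cong refl) (simp add: less_imp_neq[symmetric])
  have "(\<lambda>m. G p (t m) lam) \<longlonglongrightarrow> G p \<theta> lam"
    unfolding G unfolding G_def s_def[symmetric] by (intro tendsto_sum conv)
  moreover have "G p (t m) lam = block_scale lam (es m) / real (binary_value (es m)) powr (1 - lam)" for m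
    unfolding val unfolding es_def by (rule G_eq_block_scale[OF Npos]) (simp add: t_def)
  ultimately have "(\<lambda>m. block_scale lam (es m) / real (binary_value (es m)) powr (1 - lam)) \<longlonglongrightarrow> G p \<theta> lam"
    by simp
  moreover have "sorted_wrt (>) (es m)" for m
    unfolding es_def using dec[of m] by (rule sorted_map_exponents) simp
  moreover have "strict_mono (\<lambda>m. binary_value (es m))"
    unfolding val by (rule mono)
  ultimately show ?thesis by (intro that[of es])
qed

text \<open>For the digits of \<open>3\<close> the claim is \<open>2 * 4 powr (- lam) + 1 > 3 * 3 powr (- lam)\<close>. By the weighted inequality of
  means the left-hand side is at least \<open>3 * 16 powr (- lam / 3)\<close>, and \<open>16 < 27 = 3 ^ 3\<close>.\<close>

lemma two_block_scale_gt:
  assumes lam: "0 < lam" "lam < 1"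
  shows "block_scale lam [1, 0] / 3 powr (1 - lam) > 1"
proof -
  have p4: "2 powr (- lam) * 2 powr (- lam) = 4 powr (- lam)"
    by (simp add: powr_mult[symmetric])
  have "3 powr (- lam) = 27 powr (- lam / 3)"
    using powr_powr[of 3 3 "- lam / 3"] by simp
  also have "\<dots> < 16 powr (- lam / 3)"
    using lam by (intro powr_less_mono2_neg) auto
  also have "16 powr (- lam / 3) = (4 powr (- lam)) powr (2/3)"
    using powr_powr[of 4 2 "- lam / 3"] by (simp add: powr_powr mult.commute)
  also have "\<dots> \<le> 2 / 3 * 4 powr (- lam) + 1 / 3"
    using Youngs_inequality_0[of "2/3" "1/3" "4 powr (- lam)" 1] by simp
  finally have "3 * 3 powr (- lam) < 2 * 4 powr (- lam) + 1" by simp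
  moreover have "3 powr (1 - lam) = 3 * 3 powr (- lam)" using powr_add[of 3 1 "- lam"] by simp
  moreover have "block_scale lam [1, 0] = 2 * 4 powr (- lam) + 1"
    using p4 by (simp add: algebra_simps)
  ultimately show ?thesis by simp
qed

section \<open>Bounds and limit points\<close>

lemma zeta_const_neg:
  assumes lam: "0 < lam" "lam < 1"
  shows "zeta_const lam < 0"
  unfolding zeta_const_def riemann_zeta_neg[OF lam]
  using suminf_powr_trapezoid_error_neg[OF lam] by (intro mult_pos_neg) auto

lemma G_bounds:
  assumes lam: "0 < lam" "lam < 1" and \<theta>: "\<theta> \<in> Theta p"
  shows "1 \<le> G p \<theta> lam" "G p \<theta> lam \<le> 2 powr (1 - lam) / (2 powr (1 - lam) - 1)"
proof -
  obtain es where es: "\<And>m. sorted_wrt (>) (es m)" "strict_mono (\<lambda>m. binary_value (es m))"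
    and lim: "(\<lambda>m. block_scale lam (es m) / real (binary_value (es m)) powr (1 - lam)) \<longlonglongrightarrow> G p \<theta> lam"
    using Theta_limit[OF lam \<theta>] by blast
  have pos: "real (binary_value (es m)) powr (1 - lam) > 0" if "m \<ge> 1" for m
    using seq_suble[OF es(2), of m] that by simp
  show "1 \<le> G p \<theta> lam"
  proof (rule LIMSEQ_le_const[OF lim], intro exI[of _ 1] allI impI)
    fix m :: nat assume "m \<ge> 1"
    from pos[OF this] block_scale_ge[OF lam es(1)[of m]]
    show "1 \<le> block_scale lam (es m) / real (binary_value (es m)) powr (1 - lam)"
      by (simp add: pos_le_divide_eq)
  qed
  show "G p \<theta> lam \<le> 2 powr (1 - lam) / (2 powr (1 - lam) - 1)"
  proof (rule LIMSEQ_le_const2[OF lim], intro exI[of _ 1] allI impI)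
    fix m :: nat assume "m \<ge> 1"
    from pos[OF this] block_scale_le_powr[OF lam es(1)[of m]]
    show "block_scale lam (es m) / real (binary_value (es m)) powr (1 - lam) \<le> 2 powr (1 - lam) / (2 powr (1 - lam) - 1)"
      by (simp only: pos_divide_le_eq)
  qed
qed

lemma G_limit_point:
  assumes lam: "0 < lam" "lam < 1" and g: "greedy_energy_seq lam a" and \<theta>: "\<theta> \<in> Theta p"
  shows "\<exists>r :: nat \<Rightarrow> nat. strict_mono r \<and> (\<forall>k. 2 \<le> r k) \<and>
       (\<lambda>k. normalized_energy lam a (r k)) \<longlonglongrightarrow> G p \<theta> lam * zeta_const lam"
proof -
  obtain es where es: "\<And>m. sorted_wrt (>) (es m)" "strict_mono (\<lambda>m. binary_value (es m))"
    and lim: "(\<lambda>m. block_scale lam (es m) / real (binary_value (es m)) powr (1 - lam)) \<longlonglongrightarrow> G p \<theta> lam"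
    using Theta_limit[OF lam \<theta>] by blast
  define x where "x m = normalized_energy lam a (binary_value (es m))" for m
  define z where "z m = zeta_const lam * (block_scale lam (es m) / real (binary_value (es m)) powr (1 - lam))" for m
  have "(\<lambda>m. x m - z m) \<longlonglongrightarrow> 0"
  proof (rule LIMSEQ_I)
    fix \<epsilon> :: real assume "\<epsilon> > 0"
    then obtain N0 where N0: "\<And>es. sorted_wrt (>) es \<Longrightarrow> N0 \<le> binary_value es \<Longrightarrow>
      \<bar>normalized_energy lam a (binary_value es)
      - zeta_const lam * (block_scale lam es / real (binary_value es) powr (1 - lam))\<bar> \<le> \<epsilon> / 2"
      using normalized_energy_asymptotics[OF lam g, of "\<epsilon> / 2"] by auto
    show "\<exists>no. \<forall>m\<ge>no. norm (x m - z m - 0) < \<epsilon>"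
    proof (intro exI[of _ N0] allI impI)
      fix m assume "N0 \<le> m"
      then have "N0 \<le> binary_value (es m)" using seq_suble[OF es(2), of m] by linarith
      from N0[OF es(1) this] \<open>\<epsilon> > 0\<close> show "norm (x m - z m - 0) < \<epsilon>"
        unfolding x_def z_def by simp
    qed
  qed
  moreover have "z \<longlonglongrightarrow> zeta_const lam * G p \<theta> lam"
    unfolding z_def[abs_def] by (intro tendsto_mult_left lim)
  ultimately have "(\<lambda>m. (x m - z m) + z m) \<longlonglongrightarrow> 0 + zeta_const lam * G p \<theta> lam"
    by (rule tendsto_add)
  then have "x \<longlonglongrightarrow> G p \<theta> lam * zeta_const lam" by (simp add: mult.commute)
  \<comment> \<open>Dropping two terms makes every index at least \<open>2\<close>.\<close>
  then have "(\<lambda>k. x (k + 2)) \<longlonglongrightarrow> G p \<theta> lam * zeta_const lam"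
    by (rule LIMSEQ_ignore_initial_segment)
  moreover have "strict_mono (\<lambda>k. binary_value (es (k + 2)))"
    using es(2) by (simp add: strict_mono_def)
  moreover have "2 \<le> binary_value (es (k + 2))" for k
    using seq_suble[OF es(2), of "k + 2"] by simp
  ultimately show ?thesis
    unfolding x_def by (intro exI[of _ "\<lambda>k. binary_value (es (k + 2))"]) simp
qed

theorem theorem3p16:
  fixes lam :: real and a :: "nat \<Rightarrow> complex"
  assumes "0 < lam" and "lam < 1"
    and "greedy_energy_seq lam a" and "a 0 = 1"
  shows "bounded (normalized_energy lam a ` {2..}) \<and>
    \<not> convergent (normalized_energy lam a) \<and>
    limsup (\<lambda>N. ereal (normalized_energy lam a N)) = ereal (zeta_const lam) \<and>
    liminf (\<lambda>N. ereal (normalized_energy lam a N)) = g_bar lam * ereal (zeta_const lam) \<and>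
    (\<forall>p\<ge>1. \<forall>\<theta>\<in>Theta p. \<exists>r :: nat \<Rightarrow> nat. strict_mono r \<and> (\<forall>k. 2 \<le> r k) \<and>
       (\<lambda>k. normalized_energy lam a (r k)) \<longlonglongrightarrow> G p \<theta> lam * zeta_const lam)"
proof -
  note lam = assms(1,2)
  define x where "x = normalized_energy lam a"
  define C where "C = zeta_const lam"
  define K where "K = 2 powr (1 - lam) / (2 powr (1 - lam) - 1)"
  have C: "C < 0" unfolding C_def by (rule zeta_const_neg[OF lam])
  have sub: "\<exists>r :: nat \<Rightarrow> nat. strict_mono r \<and> (\<forall>k. 2 \<le> r k) \<and> (\<lambda>k. x (r k)) \<longlonglongrightarrow> G p \<theta> lam * C"
    if "\<theta> \<in> Theta p" for p \<theta>
    unfolding x_def C_def by (rule G_limit_point[OF lam assms(3) that])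
  have approx: "\<exists>N0. \<forall>N\<ge>N0. \<exists>p\<ge>1. \<exists>\<theta>\<in>Theta p. \<bar>x N - C * G p \<theta> lam\<bar> \<le> \<epsilon>" if "\<epsilon> > 0" for \<epsilon>
  proof -
    obtain N0 where N0: "\<And>es. sorted_wrt (>) es \<Longrightarrow> N0 \<le> binary_value es \<Longrightarrow>
      \<bar>x (binary_value es) - C * (block_scale lam es / real (binary_value es) powr (1 - lam))\<bar> \<le> \<epsilon>"
      using normalized_energy_asymptotics[OF lam assms(3) \<open>\<epsilon> > 0\<close>] unfolding x_def C_def by auto
    show ?thesis
    proof (rule exI[of _ "max 1 N0"], intro allI impI)
      fix N assume N: "max 1 N0 \<le> N"
      obtain es where es: "sorted_wrt (>) es" "binary_value es = N"
        using binary_value_surj by blast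
      with N have "es \<noteq> []" by auto
      then obtain p \<theta> where "p \<ge> 1" "\<theta> \<in> Theta p"
        "G p \<theta> lam = block_scale lam es / real (binary_value es) powr (1 - lam)"
        using binary_vector_in_Theta[OF es(1), of lam] by blast
      moreover have "\<bar>x N - C * (block_scale lam es / real (binary_value es) powr (1 - lam))\<bar> \<le> \<epsilon>"
        using N0[OF es(1)] es(2) N by simp
      ultimately show "\<exists>p\<ge>1. \<exists>\<theta>\<in>Theta p. \<bar>x N - C * G p \<theta> lam\<bar> \<le> \<epsilon>"
        by (intro exI[of _ p] bexI[of _ \<theta>] conjI) simp_all
    qed
  qed
  \<comment> \<open>The digits of \<open>1\<close> and of \<open>3\<close> give two different limit points, the first of which is the largest.\<close>
  obtain p1 \<theta>1 where 1: "p1 \<ge> 1" "\<theta>1 \<in> Theta p1" "G p1 \<theta>1 lam = 1"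
    using binary_vector_in_Theta[of "[0]" lam] by auto
  obtain p2 \<theta>2 where 2: "p2 \<ge> 1" "\<theta>2 \<in> Theta p2" "G p2 \<theta>2 lam > 1"
  proof -
    obtain p \<theta> where "p \<ge> 1" "\<theta> \<in> Theta p"
      "G p \<theta> lam = block_scale lam [1, 0] / real (binary_value [1, 0]) powr (1 - lam)"
      using binary_vector_in_Theta[of "[1, 0]" lam] by auto
    moreover have "real (binary_value [1, 0]) = 3" by simp
    ultimately show ?thesis using two_block_scale_gt[OF lam] that by metis
  qed
  define L where "L = liminf (\<lambda>N. ereal (x N))"

  have bounded: "bounded (x ` {2..})"
  proof -
    obtain N0 where N0: "\<And>N. N \<ge> N0 \<Longrightarrow> \<exists>p\<ge>1. \<exists>\<theta>\<in>Theta p. \<bar>x N - C * G p \<theta> lam\<bar> \<le> 1"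
      using approx[of 1] by auto
    have "\<bar>x N\<bar> \<le> 1 + \<bar>C\<bar> * K" if N: "N \<ge> N0" for N
    proof -
      obtain p \<theta> where \<theta>: "\<theta> \<in> Theta p" "\<bar>x N - C * G p \<theta> lam\<bar> \<le> 1" using N0[OF N] by blast
      have "\<bar>C * G p \<theta> lam\<bar> \<le> \<bar>C\<bar> * K"
        unfolding abs_mult using G_bounds[OF lam \<theta>(1)] by (intro mult_left_mono) (auto simp: K_def)
      with \<theta>(2) show ?thesis by linarith
    qed
    then have "bounded (x ` {N0..})"
      by (intro boundedI[of _ "1 + \<bar>C\<bar> * K"]) auto
    moreover have "bounded (x ` {..<N0})" by (intro finite_imp_bounded) simp
    ultimately have "bounded (x ` {..<N0} \<union> x ` {N0..})" by (rule bounded_Un[THEN iffD2, OF conjI, rotated])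
    moreover have "x ` {2..} \<subseteq> x ` {..<N0} \<union> x ` {N0..}" by force
    ultimately show ?thesis by (rule bounded_subset)
  qed

  have not_conv: "\<not> convergent x"
  proof
    assume "convergent x"
    then obtain l where l: "x \<longlonglongrightarrow> l" by (auto simp: convergent_def)
    have "G p \<theta> lam * C = l" if \<theta>: "\<theta> \<in> Theta p" for p \<theta>
    proof -
      obtain r :: "nat \<Rightarrow> nat" where r: "strict_mono r" "(\<lambda>k. x (r k)) \<longlonglongrightarrow> G p \<theta> lam * C"
        using sub[OF \<theta>] by blast
      show ?thesis
        using LIMSEQ_unique[OF r(2) LIMSEQ_subseq_LIMSEQ[OF l r(1), unfolded o_def]] .
    qed
    from this[OF 1(2)] this[OF 2(2)] have "G p2 \<theta>2 lam * C = 1 * C" using 1(3) by simp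
    then show False using C 2(3) by simp
  qed

  have "limsup (\<lambda>N. ereal (x N)) = ereal C"
  proof (rule antisym)
    show "limsup (\<lambda>N. ereal (x N)) \<le> ereal C"
    proof (rule ereal_le_epsilon2)
      fix \<epsilon> :: real assume "\<epsilon> > 0"
      then obtain N0 where N0: "\<And>N. N \<ge> N0 \<Longrightarrow> \<exists>p\<ge>1. \<exists>\<theta>\<in>Theta p. \<bar>x N - C * G p \<theta> lam\<bar> \<le> \<epsilon>"
        using approx by blast
      have "x N \<le> C + \<epsilon>" if N: "N \<ge> N0" for N
      proof -
        obtain p \<theta> where \<theta>: "\<theta> \<in> Theta p" "\<bar>x N - C * G p \<theta> lam\<bar> \<le> \<epsilon>" using N0[OF N] by blast
        have "C * G p \<theta> lam \<le> C * 1" using C G_bounds(1)[OF lam \<theta>(1)] by (intro mult_left_mono_neg) auto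
        with \<theta>(2) show ?thesis by linarith
      qed
      then show "limsup (\<lambda>N. ereal (x N)) \<le> ereal C + ereal \<epsilon>"
        by (intro Limsup_bounded) (auto simp: eventually_sequentially)
    qed
    obtain r :: "nat \<Rightarrow> nat" where r: "strict_mono r" "(\<lambda>k. x (r k)) \<longlonglongrightarrow> G p1 \<theta>1 lam * C"
      using sub[OF 1(2)] by blast
    then have "(\<lambda>k. ereal (x (r k))) \<longlonglongrightarrow> ereal C" using 1(3) by simp
    then have "ereal C = limsup ((\<lambda>N. ereal (x N)) \<circ> r)"
      unfolding o_def by (intro lim_imp_Limsup[symmetric]) auto
    also have "\<dots> \<le> limsup (\<lambda>N. ereal (x N))" by (rule limsup_subseq_mono[OF r(1)])
    finally show "ereal C \<le> limsup (\<lambda>N. ereal (x N))" .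
  qed

  moreover have "L = g_bar lam * ereal C"
  proof -
    have up: "g_bar lam \<le> ereal K"
      unfolding g_bar_def g_bar_p_def using G_bounds(2)[OF lam] by (intro SUP_least) (simp add: K_def)
    have G_le: "ereal (G p \<theta> lam) \<le> g_bar lam" if "p \<ge> 1" "\<theta> \<in> Theta p" for p \<theta>
      unfolding g_bar_def g_bar_p_def using that by (intro SUP_upper2[of p] SUP_upper) auto
    have "ereal 1 \<le> g_bar lam" using G_le[OF 1(1,2)] 1(3) by simp
    \<comment> \<open>The supremum is finite, so that multiplication by the negative number \<open>C\<close> reverses inequalities as for reals.\<close>
    with up obtain gb where gb: "g_bar lam = ereal gb"
      by (cases "g_bar lam") auto
    have L_le: "L \<le> ereal (G p \<theta> lam * C)" if \<theta>: "\<theta> \<in> Theta p" for p \<theta>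
    proof -
      obtain r :: "nat \<Rightarrow> nat" where r: "strict_mono r" "(\<lambda>k. x (r k)) \<longlonglongrightarrow> G p \<theta> lam * C"
        using sub[OF \<theta>] by blast
      have "L \<le> liminf ((\<lambda>N. ereal (x N)) \<circ> r)"
        unfolding L_def by (rule liminf_subseq_mono[OF r(1)])
      also have "\<dots> = ereal (G p \<theta> lam * C)"
        unfolding o_def using r(2) by (intro lim_imp_Liminf) auto
      finally show ?thesis .
    qed
    have ge: "ereal (gb * C) \<le> L"
    proof (rule ereal_le_epsilon2)
      fix \<epsilon> :: real assume "\<epsilon> > 0"
      then obtain N0 where N0: "\<And>N. N \<ge> N0 \<Longrightarrow> \<exists>p\<ge>1. \<exists>\<theta>\<in>Theta p. \<bar>x N - C * G p \<theta> lam\<bar> \<le> \<epsilon>"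
        using approx by blast
      have "gb * C - \<epsilon> \<le> x N" if N: "N \<ge> N0" for N
      proof -
        obtain p \<theta> where \<theta>: "p \<ge> 1" "\<theta> \<in> Theta p" "\<bar>x N - C * G p \<theta> lam\<bar> \<le> \<epsilon>" using N0[OF N] by blast
        have "G p \<theta> lam \<le> gb" using G_le[OF \<theta>(1,2)] gb by simp
        then have "C * gb \<le> C * G p \<theta> lam" using C by (intro mult_left_mono_neg) auto
        with \<theta>(3) show ?thesis by (simp add: mult.commute)
      qed
      then have "ereal (gb * C - \<epsilon>) \<le> L"
        unfolding L_def by (intro Liminf_bounded) (auto simp: eventually_sequentially)
      then show "ereal (gb * C) \<le> L + ereal \<epsilon>"
        by (cases L) auto
    qed
    moreover have "L \<le> ereal C" using L_le[OF 1(2)] 1(3) by simp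
    ultimately obtain l where l: "L = ereal l" by (cases L) auto
    have "G p \<theta> lam \<le> l / C" if "\<theta> \<in> Theta p" for p \<theta>
      using L_le[OF that] l C by (simp add: neg_le_divide_eq)
    then have "g_bar lam \<le> ereal (l / C)"
      unfolding g_bar_def g_bar_p_def by (intro SUP_least) simp
    then have "l \<le> gb * C" using gb C by (simp add: neg_le_divide_eq)
    with ge have "L = ereal (gb * C)" unfolding l by simp
    then show ?thesis by (simp add: gb)
  qed
  ultimately show ?thesis
    using bounded not_conv sub unfolding x_def C_def L_def by blast
qed

end
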